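(* Let $\alpha_1,\alpha_2>-1$ and $\alpha>-\min(1,1+\alpha_1,1+\alpha_2)$ with $\alpha\neq0$, and let $W_1^{0,\rm J}(x)$ be the Stieltjes transform of the limiting eigenvalue density of the Jacobi $\beta$-ensemble with $\beta=2\alpha/N$ (see context). Then $W_1^{0,\rm J}$ satisfies the Riccati equation $$-\frac{d}{dx}W_1^{0,\rm J}(x)+\Big(\frac{\alpha_1}{x}-\frac{\alpha_2}{1-x}\Big)W_1^{0,\rm J}(x)+\frac{1+\alpha_1+\alpha_2+\alpha}{x(1-x)}+\alpha\big(W_1^{0,\rm J}(x)\big)^2=0,$$ and $$W_1^{0,\rm J}(x)=-\frac{\psi'(x)}{\alpha\,\psi(x)},$$ where $\psi$ satisfies the hypergeometric differential equation $$x(x-1)\psi''(x)+\big(\alpha_1-(\alpha_1+\alpha_2)x\big)\psi'(x)-\alpha\,(1+\alpha+\alpha_1+\alpha_2)\,\psi(x)=0$$ with $\psi(x)\sim C_1x^{-\alpha}$ as $|x|\to\infty$ for a nonzero constant $C_1$, and explicitly $$\psi(x)=C_1\,x^{-\alpha}\,{}_2F_1\big(\alpha,\;\alpha+\alpha_1+1;\;2\alpha+\alpha_1+\alpha_2+2;\;x^{-1}\big).$$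
   Context: The Jacobi $\beta$-ensemble is the probability density on $(0,1)^N$ proportional to $\prod_{l=1}^N\lambda_l^{\alpha_1}(1-\lambda_l)^{\alpha_2}\prod_{1\le j<k\le N}|\lambda_k-\lambda_j|^\beta$. Here $\beta=2\alpha/N$ with $\alpha,\alpha_1,\alpha_2$ fixed, and $N\to\infty$. Standing assumption (large-$N$ ansatz): for every $n\ge1$ and all integers $p_1,\dots,p_n\ge0$, the joint cumulant of $\sum_j\lambda_j^{p_1},\dots,\sum_j\lambda_j^{p_n}$ (with $\beta=2\alpha/N$) has, as $N\to\infty$, an asymptotic expansion $N\sum_{l\ge0}c^{(l)}_{p_1,\dots,p_n}N^{-l}$ with coefficients independent of $N$. $W_1^{0,\rm J}(x)=\lim_{N\to\infty}\frac1N\big\langle\sum_{j=1}^N\frac1{x-\lambda_j}\big\rangle=\int_0^1\frac{\rho^{\rm J}_{(1),0}(\lambda)}{x-\lambda}\,d\lambda$, where $\rho^{\rm J}_{(1),0}$ is the limiting eigenvalue density normalised to integrate to one. The formula for $W_1^{0,\rm J}$ in terms of $\psi$ is understood for $x$ near infinity (e.g. $|x|>1$ away from zeros of $\psi$, any local branch of $x^{-\alpha}$, which cancels in the logarithmic derivative) and by analytic continuation elsewhere. ${}_2F_1$ is the Gauss hypergeometric function. *)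

theory Defs
  imports
    "HOL-Analysis.Analysis"
    "HOL-Library.Landau_Symbols"
    "HOL-Library.Disjoint_Sets"
begin

section \<open>The Jacobi beta-ensemble\<close>

text \<open>The eigenvalues are the coordinates \<open>0, \<dots>, N - 1\<close> of a point of \<open>\<real>\<^sup>N\<close>, and the
  unnormalised density is extended by zero outside the cube \<open>(0,1)\<^sup>N\<close>.\<close>

definition jacobi_weight :: "nat \<Rightarrow> real \<Rightarrow> real \<Rightarrow> real \<Rightarrow> (nat \<Rightarrow> real) \<Rightarrow> real" where
  "jacobi_weight N \<alpha>1 \<alpha>2 \<beta> y =
     (if \<forall>l<N. 0 < y l \<and> y l < 1
      then (\<Prod>l<N. y l powr \<alpha>1 * (1 - y l) powr \<alpha>2) *
           (\<Prod>k<N. \<Prod>j<k. \<bar>y k - y j\<bar> powr \<beta>)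
      else 0)"

definition jacobi_partition :: "nat \<Rightarrow> real \<Rightarrow> real \<Rightarrow> real \<Rightarrow> real" where
  "jacobi_partition N \<alpha>1 \<alpha>2 \<beta> =
     (\<integral>y. jacobi_weight N \<alpha>1 \<alpha>2 \<beta> y \<partial>(\<Pi>\<^sub>M l\<in>{..<N}. lborel))"

definition jacobi_ensemble :: "nat \<Rightarrow> real \<Rightarrow> real \<Rightarrow> real \<Rightarrow> (nat \<Rightarrow> real) measure" where
  "jacobi_ensemble N \<alpha>1 \<alpha>2 \<beta> =
     density (\<Pi>\<^sub>M l\<in>{..<N}. lborel)
       (\<lambda>y. ennreal (jacobi_weight N \<alpha>1 \<alpha>2 \<beta> y / jacobi_partition N \<alpha>1 \<alpha>2 \<beta>))"

section \<open>Joint cumulants and the large-N ansatz\<close>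

text \<open>The joint cumulant of \<open>X 0, \<dots>, X (n - 1)\<close>, by the moment-cumulant formula over set
  partitions.\<close>

definition joint_cumulant :: "'a measure \<Rightarrow> nat \<Rightarrow> (nat \<Rightarrow> 'a \<Rightarrow> real) \<Rightarrow> real" where
  "joint_cumulant M n X =
     (\<Sum>P | partition_on {..<n} P.
        (-1) ^ (card P - 1) * fact (card P - 1) * (\<Prod>B\<in>P. \<integral>\<omega>. (\<Prod>i\<in>B. X i \<omega>) \<partial>M))"

definition jacobi_cumulant ::
    "real \<Rightarrow> real \<Rightarrow> real \<Rightarrow> nat \<Rightarrow> (nat \<Rightarrow> nat) \<Rightarrow> nat \<Rightarrow> real" where
  "jacobi_cumulant \<alpha>1 \<alpha>2 \<alpha> n p N =
     joint_cumulant (jacobi_ensemble N \<alpha>1 \<alpha>2 (2 * \<alpha> / real N)) n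
       (\<lambda>i y. \<Sum>j<N. y j ^ p i)"

definition large_N_ansatz :: "real \<Rightarrow> real \<Rightarrow> real \<Rightarrow> bool" where
  "large_N_ansatz \<alpha>1 \<alpha>2 \<alpha> \<longleftrightarrow>
     (\<forall>n\<ge>1. \<forall>p::nat \<Rightarrow> nat. \<exists>c::nat \<Rightarrow> real. \<forall>m.
        (\<lambda>N. jacobi_cumulant \<alpha>1 \<alpha>2 \<alpha> n p N - real N * (\<Sum>l\<le>m. c l / real N ^ l))
          \<in> o(\<lambda>N. real N * (1 / real N ^ m)))"

section \<open>Limiting density and resolvent\<close>

text \<open>The limit is that of the normalised one-point functions, in the weak sense.\<close>

definition jacobi_limiting_density :: "real \<Rightarrow> real \<Rightarrow> real \<Rightarrow> (real \<Rightarrow> real) \<Rightarrow> bool" where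
  "jacobi_limiting_density \<alpha>1 \<alpha>2 \<alpha> \<rho> \<longleftrightarrow>
     (\<forall>t\<in>{0<..<1}. 0 \<le> \<rho> t) \<and>
     set_integrable lborel {0<..<1} \<rho> \<and>
     (LINT t:{0<..<1}|lborel. \<rho> t) = 1 \<and>
     (\<forall>f::real \<Rightarrow> real. continuous_on UNIV f \<longrightarrow>
        (\<lambda>N. (\<integral>y. (\<Sum>j<N. f (y j)) \<partial>jacobi_ensemble N \<alpha>1 \<alpha>2 (2 * \<alpha> / real N)) / real N)
          \<longlonglongrightarrow> (LINT t:{0<..<1}|lborel. f t * \<rho> t))"

definition stieltjes_transform :: "(real \<Rightarrow> real) \<Rightarrow> complex \<Rightarrow> complex" where
  "stieltjes_transform \<rho> x =
     (LINT t:{0<..<1}|lborel. complex_of_real (\<rho> t) / (x - complex_of_real t))"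

definition jacobi_resolvent :: "real \<Rightarrow> real \<Rightarrow> real \<Rightarrow> nat \<Rightarrow> complex \<Rightarrow> complex" where
  "jacobi_resolvent \<alpha>1 \<alpha>2 \<alpha> N x =
     (\<integral>y. (\<Sum>j<N. 1 / (x - complex_of_real (y j)))
        \<partial>jacobi_ensemble N \<alpha>1 \<alpha>2 (2 * \<alpha> / real N))"

definition W10J :: "real \<Rightarrow> real \<Rightarrow> real \<Rightarrow> complex \<Rightarrow> complex" where
  "W10J \<alpha>1 \<alpha>2 \<alpha> x = lim (\<lambda>N. jacobi_resolvent \<alpha>1 \<alpha>2 \<alpha> N x / of_nat N)"

section \<open>The Gauss hypergeometric function\<close>

text \<open>Outside the unit disc this is the principal branch: the analytic continuation of the
  series to the plane cut along \<open>[1,\<infinity>)\<close>.\<close>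

definition gauss_2F1 :: "complex \<Rightarrow> complex \<Rightarrow> complex \<Rightarrow> complex \<Rightarrow> complex" where
  "gauss_2F1 a b c z =
     (if norm z < 1 then eval_fps (fps_hypergeo [a, b] [c] 1) z
      else (SOME F. F holomorphic_on - (complex_of_real ` {1..}) \<and>
              (\<forall>w\<in>ball 0 1. F w = eval_fps (fps_hypergeo [a, b] [c] 1) w)) z)"

text \<open>A holomorphic branch of the logarithm on an open set \<open>U\<close> avoiding \<open>[0,1]\<close>; it fixes the
  branch \<open>exp (- \<alpha> * L x)\<close> of \<open>x\<^bsup>-\<alpha>\<^esup>\<close>.\<close>

definition log_branch_off_unit_interval :: "complex set \<Rightarrow> (complex \<Rightarrow> complex) \<Rightarrow> bool" where
  "log_branch_off_unit_interval U L \<longleftrightarrow>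
     open U \<and> U \<inter> complex_of_real ` {0..1} = {} \<and>
     L holomorphic_on U \<and> (\<forall>x\<in>U. exp (L x) = x)"

end

theory Submission
  imports Defs "HOL-Complex_Analysis.Complex_Analysis"
begin

text \<open>Substituting \<open>y \<mapsto> y + \<epsilon> y\<^bsup>p+1\<^esup>(1 - y)\<close> in every coordinate of the partition function and
  differentiating at \<open>\<epsilon> = 0\<close> gives the loop equations of the ensemble; since the weight is only
  multiplied by a bounded Jacobian, no boundary terms appear, and negative \<open>\<beta>\<close> needs no extra care.
  The ansatz (for the first two cumulants, to leading order) turns them into a recursion for the
  limiting moments \<open>m\<^sub>p\<close>, which is the Riccati equation for the power series
  \<open>K(z) = \<Sum> m\<^sub>p\<^sub>+\<^sub>1 z\<^sup>p\<close>, \<open>W(x) = (1 + K(1/x)/x)/x\<close>. By Weierstrass approximation the linear statistics of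
  all continuous functions converge, so \<open>K\<close> extends holomorphically to the plane cut along
  \<open>[1,\<infinity>)\<close>, and the Riccati equation with it. That plane is starlike, so \<open>K\<close> has a primitive \<open>H\<close>
  vanishing at \<open>0\<close>, and \<open>exp (\<alpha> H)\<close> is a solution of a hypergeometric equation that is regular
  at \<open>0\<close>: it is the Gauss function, continuation included.\<close>

section \<open>Integrability of the Jacobi weight\<close>

text \<open>The scaling \<beta> = 2 \<alpha>/N is the source of the differential equation: after
  division by N, the divergence of the vector field and the pair interaction are both of order 1, so
  a first-order linear term survives beside the quadratic one. For \<alpha> < 0 the weak exponent
  does not by itself give integrability. If all N points cluster, the N (N - 1)/2 pairs contribute a
  total exponent \<alpha> (N - 1), which competes with a dimension of the same order; in the
  interior this leads to \<alpha> > -1, at the endpoints to \<alpha> > -(1 + \<alpha>1) and \<alpha>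
  > -(1 + \<alpha>2). No limiting measure is constructed. The limit is a bounded functional on
  continuous functions, and a density, if there is one, is compared with it only at the end.
  Splitting the term 1/x off W separates the two factors of \<psi>: a primitive of 1/x gives
  x^(-\<alpha>), while K(1/x)/x^2 dx = -K(z) dz with z = 1/x gives exp (\<alpha> H(1/x)).\<close>

lemma powr_mult_le_sum:
  fixes x y p q :: real
  assumes "0 < x" "0 < y" "0 \<le> p" "0 \<le> q"
  shows "x powr -p * y powr -q \<le> x powr -(p + q) + y powr -(p + q)"
proof (cases "x \<le> y")
  case True
  have "y powr -q \<le> x powr -q" using True assms by (intro powr_mono2') auto
  then have "x powr -p * y powr -q \<le> x powr -p * x powr -q" by (intro mult_left_mono) auto
  also have "\<dots> = x powr -(p + q)" by (simp add: powr_add [symmetric])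
  finally show ?thesis by (simp add: add_increasing2)
next
  case False
  have "x powr -p \<le> y powr -p" using False assms by (intro powr_mono2') auto
  then have "x powr -p * y powr -q \<le> y powr -p * y powr -q" by (intro mult_right_mono) auto
  also have "\<dots> = y powr -(p + q)" by (simp add: powr_add [symmetric])
  finally show ?thesis by (simp add: add_increasing)
qed

lemma nn_integral_powr_unit_interval:
  fixes s :: real
  assumes "s < 1"
  shows "(\<integral>\<^sup>+t. ennreal (indicator {0..1} t * t powr -s) \<partial>lborel) = ennreal (1 / (1 - s))"
proof -
  have "((\<lambda>x. x powr -s) has_integral 1 powr (-s+1) / (-s+1)) {0..1::real}"
    by (rule has_integral_powr_from_0) (use assms in auto)
  from nn_integral_has_integral_lebesgue [OF _ this] show ?thesis
    by (simp add: nn_integral_completion)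
qed

text \<open>Whichever of u - t and t - u is nonnegative lies in [0,1]. A reflection and a
  translation turn the two cases into the integral of t^(-s) over the unit interval, hence the
  factor 2 and the independence of u.\<close>

lemma nn_integral_dist_powr_unit_interval_le:
  fixes s u :: real
  assumes s: "s < 1" and u: "u \<in> {0..1}"
  shows "(\<integral>\<^sup>+t. ennreal (indicator {0<..<1} t * \<bar>u - t\<bar> powr -s) \<partial>lborel) \<le> ennreal (2 / (1 - s))"
proof -
  let ?h = "\<lambda>t. ennreal (indicator {0..1} t * t powr -s)"
  have "(\<integral>\<^sup>+t. ennreal (indicator {0<..<1} t * \<bar>u - t\<bar> powr -s) \<partial>lborel)
      \<le> (\<integral>\<^sup>+t. ?h (u + (-1) * t) + ?h (- u + 1 * t) \<partial>lborel)"
    using u by (intro nn_integral_mono)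
      (auto simp: indicator_def ennreal_plus [symmetric] simp del: ennreal_plus intro!: ennreal_leI)
  also have "\<dots> = (\<integral>\<^sup>+t. ?h (u + (-1) * t) \<partial>lborel) + (\<integral>\<^sup>+t. ?h (- u + 1 * t) \<partial>lborel)"
    by (intro nn_integral_add) measurable
  also have "(\<integral>\<^sup>+t. ?h (u + (-1) * t) \<partial>lborel) = (\<integral>\<^sup>+t. ?h t \<partial>lborel)"
    by (subst (2) nn_integral_real_affine [where c = "-1" and t = u]) auto
  also have "(\<integral>\<^sup>+t. ?h (- u + 1 * t) \<partial>lborel) = (\<integral>\<^sup>+t. ?h t \<partial>lborel)"
    by (subst (2) nn_integral_real_affine [where c = 1 and t = "-u"]) auto
  also have "(\<integral>\<^sup>+t. ?h t \<partial>lborel) + (\<integral>\<^sup>+t. ?h t \<partial>lborel) = ennreal (2 / (1 - s))"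
    using s by (simp add: nn_integral_powr_unit_interval ennreal_plus [symmetric] del: ennreal_plus)
  finally show ?thesis .
qed

text \<open>The one-particle factor carries the cutoff to (0,1), so that the joint density becomes a
  plain product without case distinction (\<open>jacobi_weight_eq\<close>).\<close>

definition beta_weight :: "real \<Rightarrow> real \<Rightarrow> real \<Rightarrow> real" where
  "beta_weight a b t = indicator {0<..<1} t * (t powr a * (1 - t) powr b)"

lemma borel_measurable_beta_weight [measurable]: "beta_weight a b \<in> borel_measurable borel"
  unfolding beta_weight_def by measurable

lemma beta_weight_nonneg: "0 \<le> beta_weight a b t"
  by (simp add: beta_weight_def)

text \<open>Separates the singularity at 0 from the one at u. Only the negative part of a matters
  since t \<le> 1, and s is the exponent that arises when u approaches 0. In the case u = t the left
  side vanishes because 0 \<open>powr\<close> anything is 0.\<close>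

lemma powr_mult_dist_powr_le:
  fixes t u a g :: real
  assumes t: "0 < t" "t \<le> 1" and g: "0 \<le> g"
  defines "s \<equiv> g + max 0 (- a)"
  shows "t powr a * \<bar>u - t\<bar> powr -g \<le> t powr -s + \<bar>u - t\<bar> powr -s"
proof (cases "u = t")
  case False
  have "t powr a \<le> t powr -(max 0 (-a))" using t by (intro powr_mono') auto
  then have "t powr a * \<bar>u - t\<bar> powr -g \<le> t powr -(max 0 (-a)) * \<bar>u - t\<bar> powr -g"
    by (intro mult_right_mono) auto
  also have "\<dots> \<le> t powr -s + \<bar>u - t\<bar> powr -s"
    using powr_mult_le_sum [of t "\<bar>u - t\<bar>" "max 0 (-a)" g] t g False
    by (simp add: s_def add.commute)
  finally show ?thesis .
qed simp

text \<open>One of t and 1 - t is at least 1/2, and its power is then at most 2 to the absolute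
  value of the exponent. So only one endpoint is singular at a time.\<close>

lemma beta_weight_le:
  assumes "0 < t" "t < 1"
  shows "beta_weight a b t \<le> 2 powr (\<bar>a\<bar> + \<bar>b\<bar>) * (t powr a + (1 - t) powr b)"
proof -
  have half: "x powr c \<le> 2 powr \<bar>c\<bar>" if "1/2 \<le> x" "x \<le> 1" for x c :: real
  proof (cases "0 \<le> c")
    case True
    then have "x powr c \<le> 1" using that by (intro powr_le1) auto
    also have "\<dots> \<le> 2 powr \<bar>c\<bar>" by (rule ge_one_powr_ge_zero) auto
    finally show ?thesis .
  next
    case False
    then have "x powr c \<le> (1/2) powr c" using that by (intro powr_mono2') auto
    also have "\<dots> = 2 powr \<bar>c\<bar>" using False by (simp add: powr_divide powr_minus_divide)
    finally show ?thesis .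
  qed
  have e: "2 powr \<bar>a\<bar> \<le> 2 powr (\<bar>a\<bar> + \<bar>b\<bar>)" "2 powr \<bar>b\<bar> \<le> 2 powr (\<bar>a\<bar> + \<bar>b\<bar>)" by auto
  show ?thesis
  proof (cases "t \<le> 1/2")
    case True
    have "(1 - t) powr b \<le> 2 powr (\<bar>a\<bar> + \<bar>b\<bar>)" using half [of "1 - t" b] True assms e by linarith
    then have "t powr a * (1 - t) powr b \<le> t powr a * 2 powr (\<bar>a\<bar> + \<bar>b\<bar>)"
      by (intro mult_left_mono) auto
    then show ?thesis using assms by (simp add: beta_weight_def algebra_simps add_increasing2)
  next
    case False
    have "t powr a \<le> 2 powr (\<bar>a\<bar> + \<bar>b\<bar>)" using half [of t a] False assms e by linarith
    then have "t powr a * (1 - t) powr b \<le> 2 powr (\<bar>a\<bar> + \<bar>b\<bar>) * (1 - t) powr b"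
      by (intro mult_right_mono) auto
    then show ?thesis using assms by (simp add: beta_weight_def algebra_simps add_increasing)
  qed
qed

text \<open>The bound is uniform in u, even where the singularity at u merges with that at an
  endpoint: the merged exponents \<open>s1\<close> and \<open>s2\<close> stay below 1 by the three
  upper bounds on g. For g = max 0 (-\<alpha>) these bounds are the hypotheses on the
  parameters.\<close>

lemma nn_integral_beta_weight_dist_powr_bounded:
  fixes a b g :: real
  assumes "0 \<le> g" "g < 1" "g < 1 + a" "g < 1 + b"
  obtains K where "0 \<le> K"
    "\<And>u. u \<in> {0..1} \<Longrightarrow>
       (\<integral>\<^sup>+t. ennreal (beta_weight a b t * \<bar>u - t\<bar> powr -g) \<partial>lborel) \<le> ennreal K"
proof
  define s1 s2 where "s1 = g + max 0 (-a)" and "s2 = g + max 0 (-b)"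
  have s: "s1 < 1" "s2 < 1" using assms by (auto simp: s1_def s2_def max_def)
  let ?C = "2 powr (\<bar>a\<bar> + \<bar>b\<bar>)"
  define K where "K = ?C * (2/(1 - s1) + 2/(1 - s1) + (2/(1 - s2) + 2/(1 - s2)))"
  show "0 \<le> K" using s by (simp add: K_def)
  fix u :: real assume u: "u \<in> {0..1}"
  let ?I = "\<lambda>v s t. ennreal (indicator {0<..<1} t * \<bar>v - t\<bar> powr -s)"
  have "(\<integral>\<^sup>+t. ennreal (beta_weight a b t * \<bar>u - t\<bar> powr -g) \<partial>lborel)
      \<le> (\<integral>\<^sup>+t. ennreal ?C * (?I 0 s1 t + ?I u s1 t + (?I 1 s2 t + ?I u s2 t)) \<partial>lborel)"
  proof (intro nn_integral_mono)
    fix t :: real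
    show "ennreal (beta_weight a b t * \<bar>u - t\<bar> powr -g)
       \<le> ennreal ?C * (?I 0 s1 t + ?I u s1 t + (?I 1 s2 t + ?I u s2 t))"
    proof (cases "0 < t \<and> t < 1")
      case True
      have "beta_weight a b t * \<bar>u - t\<bar> powr -g
          \<le> ?C * (t powr a + (1 - t) powr b) * \<bar>u - t\<bar> powr -g"
        using True by (intro mult_right_mono beta_weight_le) auto
      \<comment> \<open>Written in 1 - u and 1 - t, the second summand has its singularity at 0, so
        the estimate for the left endpoint serves for the right one.\<close>
      also have "\<dots> = ?C * (t powr a * \<bar>u - t\<bar> powr -g
                       + (1 - t) powr b * \<bar>(1 - u) - (1 - t)\<bar> powr -g)"
        by (simp add: algebra_simps abs_minus_commute)
      also have "\<dots> \<le> ?C * ((t powr -s1 + \<bar>u - t\<bar> powr -s1)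
            + ((1 - t) powr -s2 + \<bar>(1 - u) - (1 - t)\<bar> powr -s2))"
        unfolding s1_def s2_def using True assms
        by (intro mult_left_mono add_mono powr_mult_dist_powr_le) auto
      finally show ?thesis using True
        by (simp add: ennreal_mult'' [symmetric] ennreal_plus [symmetric] ennreal_leI
              abs_minus_commute
            del: ennreal_plus)
    qed (simp add: beta_weight_def)
  qed
  also have "\<dots> = ennreal ?C * (integral\<^sup>N lborel (?I 0 s1) + integral\<^sup>N lborel (?I u s1)
      + (integral\<^sup>N lborel (?I 1 s2) + integral\<^sup>N lborel (?I u s2)))"
    by (simp add: nn_integral_cmult nn_integral_add)
  also have "\<dots> \<le> ennreal ?C * (ennreal (2/(1 - s1)) + ennreal (2/(1 - s1))
      + (ennreal (2/(1 - s2)) + ennreal (2/(1 - s2))))"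
    using s u by (intro mult_left_mono add_mono nn_integral_dist_powr_unit_interval_le) auto
  also have "\<dots> = ennreal K" using s
    by (simp add: K_def ennreal_mult'' [symmetric] ennreal_plus [symmetric] del: ennreal_plus)
  finally show "(\<integral>\<^sup>+t. ennreal (beta_weight a b t * \<bar>u - t\<bar> powr -g) \<partial>lborel) \<le> ennreal K" .
qed

text \<open>Each unordered pair is met twice on the left. Splitting an interaction into two equal
  halves thus shares it out among the single points.\<close>

lemma prod_lessThan_pairs_square:
  fixes d :: "nat \<Rightarrow> nat \<Rightarrow> 'a::comm_monoid_mult"
  assumes "\<And>k j. d k j = d j k"
  shows "(\<Prod>k<n. \<Prod>j\<in>{..<n} - {k}. d k j) = (\<Prod>k<n. \<Prod>j<k. d k j) * (\<Prod>k<n. \<Prod>j<k. d k j)"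
proof (induction n)
  case (Suc n)
  have "{..<Suc n} - {k} = insert n ({..<n} - {k})" if "k < n" for k using that by auto
  then have "(\<Prod>k<n. \<Prod>j\<in>{..<Suc n} - {k}. d k j) = (\<Prod>k<n. d n k * (\<Prod>j\<in>{..<n} - {k}. d k j))"
    using assms by (intro prod.cong) (auto intro!: prod.insert)
  moreover have "{..<Suc n} - {n} = {..<n}" by auto
  ultimately show ?case by (simp add: Suc prod.distrib ac_simps)
qed simp

text \<open>Every factor is at most the largest one, whose power is among the summands. For
  integrability this crude form of the inequality of arithmetic and geometric means is
  enough.\<close>

lemma prod_le_sum_power_card:
  fixes f :: "'a \<Rightarrow> real"
  assumes "finite A" "A \<noteq> {}" "\<And>k. k \<in> A \<Longrightarrow> 0 \<le> f k"
  shows "(\<Prod>k\<in>A. f k) \<le> (\<Sum>k\<in>A. f k ^ card A)"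
proof -
  have "Max (f ` A) \<in> f ` A" using assms by (intro Max_in) auto
  then obtain m where "m \<in> A" "Max (f ` A) = f m" by auto
  with \<open>finite A\<close> have m: "m \<in> A" "\<And>k. k \<in> A \<Longrightarrow> f k \<le> f m"
    by (auto simp flip: \<open>Max (f ` A) = f m\<close>)
  have "(\<Prod>k\<in>A. f k) \<le> (\<Prod>k\<in>A. f m)" using assms m by (intro prod_mono) auto
  also have "\<dots> = f m ^ card A" by simp
  also have "\<dots> \<le> (\<Sum>k\<in>A. f k ^ card A)"
    using assms m by (intro member_le_sum) auto
  finally show ?thesis .
qed

lemma jacobi_weight_eq:
  "jacobi_weight N a b \<beta> y =
     (\<Prod>l<N. beta_weight a b (y l)) * (\<Prod>k<N. \<Prod>j<k. \<bar>y k - y j\<bar> powr \<beta>)"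
proof (cases "\<forall>l<N. 0 < y l \<and> y l < 1")
  case True
  then have "(\<Prod>l<N. beta_weight a b (y l)) = (\<Prod>l<N. y l powr a * (1 - y l) powr b)"
    by (intro prod.cong) (auto simp: beta_weight_def)
  with True show ?thesis by (simp add: jacobi_weight_def)
next
  case False
  then obtain l where "l < N" "y l \<notin> {0<..<1}" by auto
  then have "(\<Prod>l<N. beta_weight a b (y l)) = 0"
    by (intro prod_zero bexI [of _ l]) (auto simp: beta_weight_def)
  with False show ?thesis by (simp only: jacobi_weight_def mult_zero_left if_False)
qed

lemma beta_weight_pos: "0 < t \<Longrightarrow> t < 1 \<Longrightarrow> 0 < beta_weight a b t"
  by (simp add: beta_weight_def)

lemma jacobi_weight_nonneg: "0 \<le> jacobi_weight N a b \<beta> y"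
  unfolding jacobi_weight_eq by (intro mult_nonneg_nonneg prod_nonneg) (auto simp: beta_weight_nonneg)

abbreviation lborel_PiM :: "nat \<Rightarrow> (nat \<Rightarrow> real) measure" where
  "lborel_PiM N \<equiv> \<Pi>\<^sub>M l\<in>{..<N}. lborel"

lemma borel_measurable_PiM_component:
  assumes "l \<in> I"
  shows "(\<lambda>y. y l) \<in> borel_measurable (\<Pi>\<^sub>M l\<in>I. (lborel :: real measure))"
  using measurable_component_singleton [OF assms, of "\<lambda>_. lborel"] by simp

lemma borel_measurable_jacobi_weight [measurable]:
  "jacobi_weight N a b \<beta> \<in> borel_measurable (lborel_PiM N)"
proof -
  have "(\<lambda>y. (\<Prod>l<N. beta_weight a b (y l)) * (\<Prod>k<N. \<Prod>j<k. \<bar>y k - y j\<bar> powr \<beta>))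
      \<in> borel_measurable (lborel_PiM N)"
    by (intro borel_measurable_times borel_measurable_prod powr_real_measurable
        borel_measurable_abs borel_measurable_diff borel_measurable_const borel_measurable_PiM_component
        measurable_compose [OF borel_measurable_PiM_component borel_measurable_beta_weight]) auto
  then show ?thesis by (subst jacobi_weight_eq [abs_def])
qed

text \<open>Distributing \<open>\<Prod>\<^sub>j\<^sub><\<^sub>k |y\<^sub>k - y\<^sub>j|\<^bsup>-2g/N\<^esup>\<close> over the \<open>N\<close> points and bounding the product of
  \<open>N\<close> factors by the sum of their \<open>N\<close>-th powers leaves, in each summand, interactions with a single
  point only; this is what turns the hypothesis on \<open>\<alpha>\<close> into integrability for every \<open>N\<close>.\<close>

lemma jacobi_weight_le:
  assumes g: "0 \<le> g" "-g \<le> \<alpha>" and N: "0 < N"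
  shows "jacobi_weight N a b (2 * \<alpha> / real N) y \<le>
    (\<Sum>k<N. (\<Prod>l<N. beta_weight a b (y l)) * (\<Prod>j\<in>{..<N} - {k}. \<bar>y k - y j\<bar> powr -g))"
proof (cases "\<forall>l<N. 0 < y l \<and> y l < 1")
  case False
  then obtain l where "l < N" "y l \<notin> {0<..<1}" by auto
  then have "(\<Prod>l<N. beta_weight a b (y l)) = 0"
    by (intro prod_zero bexI [of _ l]) (auto simp: beta_weight_def)
  then show ?thesis by (simp only: jacobi_weight_eq)  simp
next
  case True
  have dist: "\<bar>y k - y j\<bar> \<le> 1" if "k < N" "j < N" for k j
    using True that by (smt (verit))
  have pw: "(x powr (- g / N)) ^ N = x powr -g" for x :: real
    using N by (cases "x = 0") (auto simp: powr_power)
  let ?d = "\<lambda>k j. \<bar>y k - y j\<bar> powr (- g / N)"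
  \<comment> \<open>All distances are at most 1, so lowering the exponent from 2 \<alpha>/N to -2
    g/N can only increase a factor.\<close>
  have "(\<Prod>k<N. \<Prod>j<k. \<bar>y k - y j\<bar> powr (2 * \<alpha> / real N)) \<le> (\<Prod>k<N. \<Prod>j<k. \<bar>y k - y j\<bar> powr (- (2 * g) / real N))"
    using g N by (intro prod_mono conjI prod_nonneg powr_mono' dist divide_right_mono) auto
  also have "\<dots> = (\<Prod>k<N. \<Prod>j<k. ?d k j) * (\<Prod>k<N. \<Prod>j<k. ?d k j)"
    by (simp add: powr_add [symmetric] prod.distrib [symmetric])
  also have "\<dots> = (\<Prod>k<N. \<Prod>j\<in>{..<N} - {k}. ?d k j)"
    by (rule prod_lessThan_pairs_square [symmetric]) (simp add: abs_minus_commute)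
  also have "\<dots> \<le> (\<Sum>k<N. (\<Prod>j\<in>{..<N} - {k}. ?d k j) ^ N)"
    using prod_le_sum_power_card [of "{..<N}" "\<lambda>k. \<Prod>j\<in>{..<N} - {k}. ?d k j"] N
    by (simp add: prod_nonneg lessThan_empty_iff)
  also have "\<dots> = (\<Sum>k<N. \<Prod>j\<in>{..<N} - {k}. \<bar>y k - y j\<bar> powr -g)"
    by (simp only: prod_power_distrib pw)
  finally have "jacobi_weight N a b (2 * \<alpha> / real N) y \<le>
     (\<Prod>l<N. beta_weight a b (y l)) * (\<Sum>k<N. \<Prod>j\<in>{..<N} - {k}. \<bar>y k - y j\<bar> powr -g)"
    unfolding jacobi_weight_eq by (intro mult_left_mono prod_nonneg) (auto simp: beta_weight_nonneg)
  then show ?thesis by (simp add: sum_distrib_left)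
qed

lemma product_sigma_finite_lborel: "product_sigma_finite (\<lambda>_. lborel :: real measure)"
  by (simp add: product_sigma_finite_def lborel.sigma_finite_measure_axioms)

text \<open>With y k = u fixed, a summand of \<open>jacobi_weight_le\<close> is a product of
  functions of the other single coordinates. Its integral over them is a product of N - 1
  one-dimensional integrals, each bounded uniformly in u; what remains is the integral of
  \<open>beta_weight\<close> over u.\<close>

lemma nn_integral_jacobi_weight_finite:
  assumes "a > -1" "b > -1" and \<alpha>: "\<alpha> > - min 1 (min (1 + a) (1 + b))" and N: "0 < N"
  shows "(\<integral>\<^sup>+y. ennreal (jacobi_weight N a b (2 * \<alpha> / real N) y) \<partial>lborel_PiM N) < \<infinity>"
proof -
  interpret product_sigma_finite "\<lambda>_::nat. lborel :: real measure"
    by (rule product_sigma_finite_lborel)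
  \<comment> \<open>The strength of the attraction; it is 0 in the repulsive case \<alpha> \<ge> 0,
    where the interaction is bounded by 1.\<close>
  define g where "g = max 0 (-\<alpha>)"
  have g: "0 \<le> g" "g < 1" "g < 1 + a" "g < 1 + b" "-g \<le> \<alpha>"
    using assms by (auto simp: g_def)
  obtain K where K: "0 \<le> K" "\<And>u. u \<in> {0..1} \<Longrightarrow>
       (\<integral>\<^sup>+t. ennreal (beta_weight a b t * \<bar>u - t\<bar> powr -g) \<partial>lborel) \<le> ennreal K"
    using nn_integral_beta_weight_dist_powr_bounded [OF g(1-4)] by metis
  obtain K0 where K0: "0 \<le> K0" "\<And>u. u \<in> {0..1} \<Longrightarrow>
       (\<integral>\<^sup>+t. ennreal (beta_weight a b t * \<bar>u - t\<bar> powr -0) \<partial>lborel) \<le> ennreal K0"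
    using nn_integral_beta_weight_dist_powr_bounded [of 0 a b] assms by auto
  have "(\<integral>\<^sup>+t. ennreal (beta_weight a b t) \<partial>lborel)
      = (\<integral>\<^sup>+t. ennreal (beta_weight a b t * \<bar>0 - t\<bar> powr -0) \<partial>lborel)"
    by (intro nn_integral_cong) (auto simp: beta_weight_def indicator_def)
  with K0(2) [of 0] have bw: "(\<integral>\<^sup>+t. ennreal (beta_weight a b t) \<partial>lborel) \<le> ennreal K0" by simp
  let ?f = "\<lambda>k y. (\<Prod>l<N. beta_weight a b (y l)) * (\<Prod>j\<in>{..<N} - {k}. \<bar>y k - y j\<bar> powr -g)"
  have meas [measurable]: "?f k \<in> borel_measurable (lborel_PiM N)" if "k < N" for k
    using that
    by (intro borel_measurable_times borel_measurable_prod powr_real_measurable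
        borel_measurable_abs borel_measurable_diff borel_measurable_const borel_measurable_PiM_component
        measurable_compose [OF borel_measurable_PiM_component borel_measurable_beta_weight]) auto
  have fin: "(\<integral>\<^sup>+y. ennreal (?f k y) \<partial>lborel_PiM N) < \<infinity>" if k: "k < N" for k
  proof -
    let ?I = "{..<N} - {k}"
    have ins: "{..<N} = insert k ?I" using k by auto
    have "(\<integral>\<^sup>+y. ennreal (?f k y) \<partial>lborel_PiM N)
        = (\<integral>\<^sup>+y. ennreal (?f k y) \<partial>(\<Pi>\<^sub>M l\<in>insert k ?I. lborel))"
      using ins by simp
    also have "\<dots> = (\<integral>\<^sup>+ u. (\<integral>\<^sup>+ y. ennreal (?f k (y(k := u))) \<partial>(\<Pi>\<^sub>M l\<in>?I. lborel)) \<partial>lborel)"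
      by (rule product_nn_integral_insert_rev) (use meas [OF k] ins in auto)
    also have "\<dots> = (\<integral>\<^sup>+ u. ennreal (beta_weight a b u) *
        (\<integral>\<^sup>+ y. (\<Prod>j\<in>?I. ennreal (beta_weight a b (y j) * \<bar>u - y j\<bar> powr -g)) \<partial>(\<Pi>\<^sub>M l\<in>?I. lborel)) \<partial>lborel)"
    proof (intro nn_integral_cong)
      fix u :: real
      have "ennreal (?f k (y(k := u))) =
          ennreal (beta_weight a b u) * (\<Prod>j\<in>?I. ennreal (beta_weight a b (y j) * \<bar>u - y j\<bar> powr -g))" for y
      proof -
        have "(\<Prod>l<N. beta_weight a b ((y(k := u)) l)) = beta_weight a b u * (\<Prod>l\<in>?I. beta_weight a b (y l))"
          by (subst ins, subst prod.insert) (auto intro!: prod.cong)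
        then have "?f k (y(k := u)) = beta_weight a b u * (\<Prod>j\<in>?I. beta_weight a b (y j) * \<bar>u - y j\<bar> powr -g)"
          by (simp add: prod.distrib)
        then show ?thesis
          by (simp only:) (subst prod_ennreal, simp_all add: beta_weight_nonneg ennreal_mult'' prod_nonneg)
      qed
      then show "(\<integral>\<^sup>+ y. ennreal (?f k (y(k := u))) \<partial>(\<Pi>\<^sub>M l\<in>?I. lborel)) = ennreal (beta_weight a b u) *
        (\<integral>\<^sup>+ y. (\<Prod>j\<in>?I. ennreal (beta_weight a b (y j) * \<bar>u - y j\<bar> powr -g)) \<partial>(\<Pi>\<^sub>M l\<in>?I. lborel))"
        by (simp only:) (rule nn_integral_cmult, intro borel_measurable_prod_ennreal measurable_compose [OF _ measurable_ennreal]
           borel_measurable_times powr_real_measurable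
           borel_measurable_abs borel_measurable_diff borel_measurable_const borel_measurable_PiM_component
           measurable_compose [OF borel_measurable_PiM_component borel_measurable_beta_weight])
    qed
    also have "\<dots> = (\<integral>\<^sup>+ u. ennreal (beta_weight a b u) *
        (\<Prod>j\<in>?I. \<integral>\<^sup>+ t. ennreal (beta_weight a b t * \<bar>u - t\<bar> powr -g) \<partial>lborel) \<partial>lborel)"
      by (subst product_nn_integral_prod) auto
    also have "\<dots> \<le> (\<integral>\<^sup>+ u. ennreal (beta_weight a b u) * (\<Prod>j\<in>?I. ennreal K) \<partial>lborel)"
    proof (intro nn_integral_mono)
      fix u :: real
      show "ennreal (beta_weight a b u) * (\<Prod>j\<in>?I. \<integral>\<^sup>+ t. ennreal (beta_weight a b t * \<bar>u - t\<bar> powr -g) \<partial>lborel)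
        \<le> ennreal (beta_weight a b u) * (\<Prod>j\<in>?I. ennreal K)"
      proof (cases "u \<in> {0<..<1}")
        case True
        then show ?thesis by (auto intro!: mult_left_mono power_mono K(2))
      qed (simp add: beta_weight_def)
    qed
    also have "\<dots> = (\<integral>\<^sup>+ u. ennreal (beta_weight a b u) \<partial>lborel) * (\<Prod>j\<in>?I. ennreal K)"
      by (rule nn_integral_multc) auto
    also have "\<dots> \<le> ennreal K0 * (\<Prod>j\<in>?I. ennreal K)"
      using bw by (rule mult_right_mono) auto
    also have "\<dots> < \<infinity>"
      by (simp add: ennreal_power K(1) less_top [symmetric] ennreal_mult_eq_top_iff)
    finally show ?thesis .
  qed
  have "(\<integral>\<^sup>+y. ennreal (jacobi_weight N a b (2 * \<alpha> / real N) y) \<partial>lborel_PiM N)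
      \<le> (\<integral>\<^sup>+y. (\<Sum>k<N. ennreal (?f k y)) \<partial>lborel_PiM N)"
  proof (intro nn_integral_mono)
    fix y
    have "(\<Sum>k<N. ennreal (?f k y)) = ennreal (\<Sum>k<N. ?f k y)"
      by (intro sum_ennreal mult_nonneg_nonneg prod_nonneg) (auto simp: beta_weight_nonneg)
    then show "ennreal (jacobi_weight N a b (2 * \<alpha> / real N) y) \<le> (\<Sum>k<N. ennreal (?f k y))"
      using jacobi_weight_le [OF g(1,5) N, of a b y] by (simp add: ennreal_leI)
  qed
  also have "\<dots> = (\<Sum>k<N. \<integral>\<^sup>+y. ennreal (?f k y) \<partial>lborel_PiM N)"
    by (rule nn_integral_sum) (use meas in auto)
  also have "\<dots> < \<infinity>" using fin by (simp add: less_top [symmetric])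
  finally show ?thesis .
qed

lemma integrable_jacobi_weight:
  assumes "a > -1" "b > -1" "\<alpha> > - min 1 (min (1 + a) (1 + b))" "0 < N"
  shows "integrable (lborel_PiM N) (jacobi_weight N a b (2 * \<alpha> / real N))"
  using nn_integral_jacobi_weight_finite [OF assms]
  by (intro integrableI_nonneg) (auto simp: jacobi_weight_nonneg)

text \<open>If the l-th point is confined to the interior of the l-th of N equal subintervals, the
  points are distinct and inside (0,1), so the weight is positive. This box has volume N^(-N), which
  excludes a vanishing integral.\<close>

lemma jacobi_partition_pos:
  assumes "a > -1" "b > -1" "\<alpha> > - min 1 (min (1 + a) (1 + b))" and N: "0 < N"
  shows "0 < jacobi_partition N a b (2 * \<alpha> / real N)"
proof -
  interpret product_sigma_finite "\<lambda>_::nat. lborel :: real measure"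
    by (rule product_sigma_finite_lborel)
  let ?w = "jacobi_weight N a b (2 * \<alpha> / real N)" and ?M = "lborel_PiM N"
  have int: "integrable ?M ?w" by (rule integrable_jacobi_weight) fact+
  have "0 \<le> (\<integral>y. ?w y \<partial>?M)" by (simp add: jacobi_weight_nonneg)
  moreover have "(\<integral>y. ?w y \<partial>?M) \<noteq> 0"
  proof
    assume "(\<integral>y. ?w y \<partial>?M) = 0"
    then have ae: "AE y in ?M. ?w y = 0"
      using integral_nonneg_eq_0_iff_AE [OF int] by (simp add: jacobi_weight_nonneg)
    let ?B = "Pi\<^sub>E {..<N} (\<lambda>l. {real l / N <..< (real l + 1) / N})"
    have pos: "?w y > 0" if y: "y \<in> ?B" for y
    proof -
      have yl: "real l < y l * N" "y l * N < real l + 1" if "l < N" for l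
        using PiE_mem [OF y, of l] that N by (auto simp: field_simps)
      have cube: "0 < y l \<and> y l < 1" if "l < N" for l
      proof -
        have "0 < y l * real N" "y l * real N < 1 * real N"
          using yl [OF that] that by linarith+
        then show ?thesis using N by (simp add: zero_less_mult_iff)
      qed
      have ne: "y k \<noteq> y j" if "k < N" "j < k" for k j
      proof -
        have "y j * real N < real j + 1" "real k < y k * real N" using yl that by auto
        moreover have "real j + 1 \<le> real k" using that by simp
        ultimately have "y j * real N < y k * real N" by linarith
        then show ?thesis by auto
      qed
      show ?thesis unfolding jacobi_weight_eq
        using cube ne by (intro mult_pos_pos prod_pos) (auto intro!: beta_weight_pos)
    qed
    have B: "?B \<in> sets ?M" by (intro sets_PiM_I_finite) auto
    have "AE y in ?M. y \<notin> ?B" using ae pos by (auto elim!: eventually_mono simp: less_le)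
    then have "emeasure ?M ?B = 0"
      using AE_iff_null_sets [OF B] by blast
    moreover have "emeasure ?M ?B = (\<Prod>l<N. ennreal (1 / N))"
      using N by (subst emeasure_PiM) (auto intro!: prod.cong simp: diff_divide_distrib [symmetric] divide_right_mono)
    ultimately show False using N by simp
  qed
  ultimately show ?thesis by (simp add: jacobi_partition_def)
qed

lemma emeasure_jacobi_ensemble_space:
  assumes "a > -1" "b > -1" "\<alpha> > - min 1 (min (1 + a) (1 + b))" "0 < N"
  shows "emeasure (jacobi_ensemble N a b (2 * \<alpha> / real N))
    (space (jacobi_ensemble N a b (2 * \<alpha> / real N))) = 1"
proof -
  let ?w = "jacobi_weight N a b (2 * \<alpha> / real N)" and ?Z = "jacobi_partition N a b (2 * \<alpha> / real N)"
  have Z: "0 < ?Z" by (rule jacobi_partition_pos) fact+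
  have "emeasure (jacobi_ensemble N a b (2 * \<alpha> / real N)) (space (jacobi_ensemble N a b (2 * \<alpha> / real N)))
      = (\<integral>\<^sup>+y. ennreal (?w y / ?Z) \<partial>lborel_PiM N)"
    unfolding jacobi_ensemble_def by (subst emeasure_density) (auto intro!: nn_integral_cong)
  also have "\<dots> = ennreal (\<integral>y. ?w y / ?Z \<partial>lborel_PiM N)"
    using Z integrable_jacobi_weight [OF assms]
    by (intro nn_integral_eq_integral) (auto simp: jacobi_weight_nonneg)
  also have "(\<integral>y. ?w y / ?Z \<partial>lborel_PiM N) = 1"
    using Z by (simp add: jacobi_partition_def)
  finally show ?thesis by simp
qed

section \<open>Loop equations\<close>

text \<open>By \<open>sub\<close>, T transports the measure g dt to Lebesgue measure on [0,1]. Both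
  sides therefore integrate f against the same product measure, identified by its values on boxes;
  since the substitution acts coordinatewise, one-dimensional calculus suffices.\<close>

lemma nn_integral_PiM_substitution:
  fixes T :: "real \<Rightarrow> real" and g :: "real \<Rightarrow> ennreal"
  assumes [measurable]: "T \<in> borel_measurable borel" "g \<in> borel_measurable borel"
    and sub: "\<And>A. A \<in> sets borel \<Longrightarrow>
      (\<integral>\<^sup>+t. g t * indicator A (T t) \<partial>lborel) = (\<integral>\<^sup>+t. indicator {0..1} t * indicator A t \<partial>lborel)"
    and I: "finite I"
    and f [measurable]: "f \<in> borel_measurable (\<Pi>\<^sub>M l\<in>I. lborel)"
  shows "(\<integral>\<^sup>+y. (\<Prod>l\<in>I. g (y l)) * f (\<lambda>l\<in>I. T (y l)) \<partial>(\<Pi>\<^sub>M l\<in>I. lborel)) =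
         (\<integral>\<^sup>+y. (\<Prod>l\<in>I. indicator {0..1} (y l)) * f y \<partial>(\<Pi>\<^sub>M l\<in>I. lborel))"
proof -
  let ?P = "\<Pi>\<^sub>M l\<in>I. (lborel :: real measure)"
  let ?U = "density lborel (indicator {0..1::real})"
  interpret L: product_sigma_finite "\<lambda>_. lborel :: real measure"
    by (rule product_sigma_finite_lborel)
  have "finite_measure ?U"
    by (rule finite_measureI) (simp add: emeasure_density)
  then interpret U: product_sigma_finite "\<lambda>_. ?U"
    by (simp add: product_sigma_finite_def finite_measure.axioms(1))
  have T [measurable]: "(\<lambda>y. \<lambda>l\<in>I. T (y l)) \<in> measurable ?P ?P"
    by (intro measurable_restrict) (auto intro!: measurable_compose [OF borel_measurable_PiM_component])
  have prod [measurable]: "(\<lambda>y. \<Prod>l\<in>I. h (y l)) \<in> borel_measurable ?P"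
    if "h \<in> borel_measurable borel" for h :: "real \<Rightarrow> ennreal"
    using that by (intro borel_measurable_prod_ennreal) (auto intro!: measurable_compose [OF borel_measurable_PiM_component])
  have setsU: "sets (\<Pi>\<^sub>M l\<in>I. ?U) = sets ?P"
    by (intro sets_PiM_cong) auto
  have box: "(\<integral>\<^sup>+y. (\<Prod>l\<in>I. h (y l)) * indicator (Pi\<^sub>E I A) (\<lambda>l\<in>I. S (y l)) \<partial>?P)
      = (\<Prod>l\<in>I. \<integral>\<^sup>+t. h t * indicator (A l) (S t) \<partial>lborel)"
    if [measurable]: "h \<in> borel_measurable borel" "S \<in> borel_measurable borel"
      and A: "\<And>l. l \<in> I \<Longrightarrow> A l \<in> sets borel" for h :: "real \<Rightarrow> ennreal" and S A
  proof -
    have "(\<integral>\<^sup>+y. (\<Prod>l\<in>I. h (y l)) * indicator (Pi\<^sub>E I A) (\<lambda>l\<in>I. S (y l)) \<partial>?P)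
       = (\<integral>\<^sup>+y. (\<Prod>l\<in>I. h (y l) * indicator (A l) (S (y l))) \<partial>?P)"
    proof (intro nn_integral_cong)
      fix y :: "'a \<Rightarrow> real"
      have "indicator (Pi\<^sub>E I A) (\<lambda>l\<in>I. S (y l)) = (\<Prod>l\<in>I. indicator (A l) (S (y l)) :: ennreal)"
      proof (cases "\<forall>l\<in>I. S (y l) \<in> A l")
        case True
        then show ?thesis by (simp add: PiE_iff extensional_restrict)
      next
        case False
        then obtain l where "l \<in> I" "S (y l) \<notin> A l" by auto
        then have "(\<Prod>l\<in>I. indicator (A l) (S (y l)) :: ennreal) = 0"
          using I by (intro prod_zero bexI [of _ l]) auto
        then show ?thesis using False by (simp add: PiE_iff indicator_def)
      qed
      then show "(\<Prod>l\<in>I. h (y l)) * indicator (Pi\<^sub>E I A) (\<lambda>l\<in>I. S (y l))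
        = (\<Prod>l\<in>I. h (y l) * indicator (A l) (S (y l)))" by (simp add: prod.distrib)
    qed
    also have "\<dots> = (\<Prod>l\<in>I. \<integral>\<^sup>+t. h t * indicator (A l) (S t) \<partial>lborel)"
      using I A by (subst L.product_nn_integral_prod) auto
    finally show ?thesis .
  qed
  have U_box: "(\<Prod>l\<in>I. emeasure ?U (A l)) = (\<Prod>l\<in>I. \<integral>\<^sup>+t. indicator {0..1} t * indicator (A l) t \<partial>lborel)"
    if "\<And>l. l \<in> I \<Longrightarrow> A l \<in> sets borel" for A
    using that by (intro prod.cong) (auto simp: emeasure_density)
  have "distr (density ?P (\<lambda>y. \<Prod>l\<in>I. g (y l))) ?P (\<lambda>y. \<lambda>l\<in>I. T (y l)) = (\<Pi>\<^sub>M l\<in>I. ?U)"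
  proof (rule U.PiM_eqI [OF I])
    fix A assume "\<And>l. l \<in> I \<Longrightarrow> A l \<in> sets ?U"
    then have A: "\<And>l. l \<in> I \<Longrightarrow> A l \<in> sets borel" by auto
    have [measurable]: "Pi\<^sub>E I A \<in> sets ?P" using A I by (intro sets_PiM_I_finite) auto
    have "emeasure (distr (density ?P (\<lambda>y. \<Prod>l\<in>I. g (y l))) ?P (\<lambda>y. \<lambda>l\<in>I. T (y l))) (Pi\<^sub>E I A)
       = (\<integral>\<^sup>+y. (\<Prod>l\<in>I. g (y l)) * indicator (Pi\<^sub>E I A) (\<lambda>l\<in>I. T (y l)) \<partial>?P)"
      by (subst nn_integral_indicator [symmetric], simp,
          subst nn_integral_distr, simp, simp, subst nn_integral_density, simp_all)
    then show "emeasure (distr (density ?P (\<lambda>y. \<Prod>l\<in>I. g (y l))) ?P (\<lambda>y. \<lambda>l\<in>I. T (y l))) (Pi\<^sub>E I A)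
      = (\<Prod>l\<in>I. emeasure ?U (A l))"
      by (simp add: box A U_box sub)
  qed (simp add: setsU)
  moreover have "density ?P (\<lambda>y. \<Prod>l\<in>I. indicator {0..1} (y l)) = (\<Pi>\<^sub>M l\<in>I. ?U)"
  proof (rule U.PiM_eqI [OF I])
    fix A assume "\<And>l. l \<in> I \<Longrightarrow> A l \<in> sets ?U"
    then have A: "\<And>l. l \<in> I \<Longrightarrow> A l \<in> sets borel" by auto
    have [measurable]: "Pi\<^sub>E I A \<in> sets ?P" using A I by (intro sets_PiM_I_finite) auto
    have "emeasure (density ?P (\<lambda>y. \<Prod>l\<in>I. indicator {0..1} (y l))) (Pi\<^sub>E I A)
       = (\<integral>\<^sup>+y. (\<Prod>l\<in>I. indicator {0..1} (y l)) * indicator (Pi\<^sub>E I A) y \<partial>?P)"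
      by (subst emeasure_density) simp_all
    also have "\<dots> = (\<integral>\<^sup>+y. (\<Prod>l\<in>I. indicator {0..1} (y l)) * indicator (Pi\<^sub>E I A) (\<lambda>l\<in>I. y l) \<partial>?P)"
      by (intro nn_integral_cong) (simp add: space_PiM PiE_restrict)
    also have "\<dots> = (\<Prod>l\<in>I. emeasure ?U (A l))"
      using box [of "indicator {0..1}" "\<lambda>t. t" A] by (simp add: A U_box)
    finally show "emeasure (density ?P (\<lambda>y. \<Prod>l\<in>I. indicator {0..1} (y l))) (Pi\<^sub>E I A)
      = (\<Prod>l\<in>I. emeasure ?U (A l))" .
  qed (simp add: setsU)
  ultimately have eq: "distr (density ?P (\<lambda>y. \<Prod>l\<in>I. g (y l))) ?P (\<lambda>y. \<lambda>l\<in>I. T (y l))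
      = density ?P (\<lambda>y. \<Prod>l\<in>I. indicator {0..1} (y l))" by simp
  have "(\<integral>\<^sup>+y. (\<Prod>l\<in>I. g (y l)) * f (\<lambda>l\<in>I. T (y l)) \<partial>?P)
      = integral\<^sup>N (distr (density ?P (\<lambda>y. \<Prod>l\<in>I. g (y l))) ?P (\<lambda>y. \<lambda>l\<in>I. T (y l))) f"
    by (subst nn_integral_distr, simp, simp, subst nn_integral_density, simp_all)
  also have "\<dots> = (\<integral>\<^sup>+y. (\<Prod>l\<in>I. indicator {0..1} (y l)) * f y \<partial>?P)"
    by (subst eq, subst nn_integral_density) simp_all
  finally show ?thesis .
qed

section \<open>Variation of the weight along a polynomial vector field\<close>

text \<open>Divided difference of \<open>t\<^sup>n\<close>, extended continuously to the diagonal.\<close>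

definition pow_dd :: "nat \<Rightarrow> real \<Rightarrow> real \<Rightarrow> real" where
  "pow_dd n x y = (\<Sum>i<n. y ^ (n - Suc i) * x ^ i)"

lemma pow_dd: "x ^ n - y ^ n = (x - y) * pow_dd n x y"
  unfolding pow_dd_def by (rule power_diff_sumr2)

lemma abs_pow_dd_le:
  assumes "x \<in> {0..1}" "y \<in> {0..1}"
  shows "\<bar>pow_dd n x y\<bar> \<le> n"
proof -
  have "\<bar>pow_dd n x y\<bar> \<le> (\<Sum>i<n. \<bar>y ^ (n - Suc i) * x ^ i\<bar>)" unfolding pow_dd_def by (rule sum_abs)
  also have "\<dots> \<le> (\<Sum>i<n. 1)"
    using assms by (intro sum_mono) (auto simp: abs_mult intro!: mult_le_one power_le_one)
  finally show ?thesis by simp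
qed

text \<open>Vanishing at 0 and at 1 makes t + e \<open>vfield p t\<close> fix both endpoints, and
  makes the logarithmic derivatives of t^a and (1 - t)^b along the field polynomials in t.\<close>

definition vfield :: "nat \<Rightarrow> real \<Rightarrow> real" where
  "vfield p t = t ^ Suc p - t ^ Suc (Suc p)"

definition vfield_deriv :: "nat \<Rightarrow> real \<Rightarrow> real" where
  "vfield_deriv p t = real (Suc p) * t ^ p - real (Suc (Suc p)) * t ^ Suc p"

definition vfield_dd :: "nat \<Rightarrow> real \<Rightarrow> real \<Rightarrow> real" where
  "vfield_dd p x y = pow_dd (Suc p) x y - pow_dd (Suc (Suc p)) x y"

lemma vfield_diff: "vfield p x - vfield p y = (x - y) * vfield_dd p x y"
  using pow_dd [of x "Suc p" y] pow_dd [of x "Suc (Suc p)" y]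
  unfolding vfield_def vfield_dd_def by (simp add: right_diff_distrib del: power_Suc)

text \<open>Logarithmic derivative at \<open>e = 0\<close> of the weight, Jacobian determinant included, along
  \<open>y \<mapsto> y + e * vfield p y\<close>.\<close>

definition loop_sum :: "nat \<Rightarrow> real \<Rightarrow> real \<Rightarrow> real \<Rightarrow> nat \<Rightarrow> (nat \<Rightarrow> real) \<Rightarrow> real" where
  "loop_sum N a b \<beta> p y =
     (\<Sum>l<N. a * (y l ^ p - y l ^ Suc p) + b * (- (y l ^ Suc p)) + vfield_deriv p (y l))
     + (\<Sum>k<N. \<Sum>j<k. \<beta> * vfield_dd p (y k) (y j))"

text \<open>Logarithm of the factor gained by the weight under y \<mapsto> T y = y + e v(y), where v
  is \<open>vfield p\<close>. It collects T y = y (1 + e (y^p - y^(p+1))), 1 - T y = (1 - y) (1 - e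
  y^(p+1)), the derivative of T, and the stretching of each difference by 1 + e
  \<open>vfield_dd\<close>.\<close>

definition log_jacobian :: "nat \<Rightarrow> real \<Rightarrow> real \<Rightarrow> real \<Rightarrow> nat \<Rightarrow> (nat \<Rightarrow> real) \<Rightarrow> real \<Rightarrow> real" where
  "log_jacobian N a b \<beta> p y e =
     (\<Sum>l<N. a * ln (1 + e * (y l ^ p - y l ^ Suc p)) + b * ln (1 + e * (- (y l ^ Suc p)))
            + ln (1 + e * vfield_deriv p (y l)))
     + (\<Sum>k<N. \<Sum>j<k. \<beta> * ln (1 + e * vfield_dd p (y k) (y j)))"

lemma log_jacobian_DERIV:
  "((\<lambda>e. exp (log_jacobian N a b \<beta> p y e)) has_real_derivative loop_sum N a b \<beta> p y) (at 0)"
  unfolding log_jacobian_def loop_sum_def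
  by (auto intro!: derivative_eq_intros sum.cong arg_cong2 [where f = "(+)"] simp: mult.commute)

lemma log_jacobian_0: "log_jacobian N a b \<beta> p y 0 = 0"
  by (simp add: log_jacobian_def)

lemma abs_vfield_deriv_le: "t \<in> {0..1} \<Longrightarrow> \<bar>vfield_deriv p t\<bar> \<le> 2 * p + 3"
proof -
  assume t: "t \<in> {0..1}"
  define A B where "A = real (Suc p) * t ^ p" and "B = real (Suc (Suc p)) * t ^ Suc p"
  have "0 \<le> A" "A \<le> real (Suc p) * 1" "0 \<le> B" "B \<le> real (Suc (Suc p)) * 1"
    using t unfolding A_def B_def
    by (intro mult_left_mono mult_nonneg_nonneg power_le_one zero_le_power of_nat_0_le_iff; simp)+
  then have "\<bar>A - B\<bar> \<le> 2 * p + 3" by simp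
  then show ?thesis by (simp only: vfield_deriv_def A_def B_def)
qed

lemma abs_vfield_dd_le: "x \<in> {0..1} \<Longrightarrow> y \<in> {0..1} \<Longrightarrow> \<bar>vfield_dd p x y\<bar> \<le> 2 * p + 3"
  using abs_pow_dd_le [of x y "Suc p"] abs_pow_dd_le [of x y "Suc (Suc p)"]
  unfolding vfield_dd_def by auto

lemma abs_ln_one_plus_le:
  fixes u :: real
  assumes "\<bar>u\<bar> \<le> 1/2"
  shows "\<bar>ln (1 + u)\<bar> \<le> 2 * \<bar>u\<bar>"
proof -
  have "\<bar>ln (1 + u) - u\<bar> \<le> 2 * u\<^sup>2" by (rule abs_ln_one_plus_x_minus_x_bound) fact
  also have "2 * u\<^sup>2 \<le> \<bar>u\<bar>"
    using mult_right_mono [OF assms, of "\<bar>u\<bar>"] by (simp add: power2_eq_square abs_mult [symmetric])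
  finally show ?thesis by linarith
qed

lemma abs_exp_minus_one_le: "\<bar>exp x - 1\<bar> \<le> \<bar>x\<bar> * exp \<bar>x\<bar>" for x :: real
proof (cases "0 \<le> x")
  case True
  have "1 - x \<le> exp (-x)" using exp_ge_add_one_self [of "-x"] by simp
  then have "(1 - x) * exp x \<le> exp (-x) * exp x" by (rule mult_right_mono) simp
  then show ?thesis using True by (simp add: exp_minus left_diff_distrib)
next
  case False
  have "1 + x \<le> exp x" by (rule exp_ge_add_one_self)
  moreover have "\<bar>x\<bar> * 1 \<le> \<bar>x\<bar> * exp \<bar>x\<bar>" by (intro mult_left_mono) auto
  moreover have "exp x \<le> 1" using False by simp
  ultimately show ?thesis using False by linarith
qed

text \<open>Every coefficient of e inside a logarithm is at most 2 p + 3 in absolute value. For e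
  \<le> 1/(2 (2 p + 3)) the argument of the logarithm stays within 1/2 of 1, which costs the factor
  2 of \<open>abs_ln_one_plus_le\<close>. The pairs are overcounted as N^2.\<close>

definition loop_bound :: "nat \<Rightarrow> real \<Rightarrow> real \<Rightarrow> real \<Rightarrow> nat \<Rightarrow> real" where
  "loop_bound N a b \<beta> p =
     2 * (2 * p + 3) * (N * (\<bar>a\<bar> + \<bar>b\<bar> + 1) + N * (N * \<bar>\<beta>\<bar>))"

lemma abs_log_jacobian_le:
  assumes y: "\<And>l. l < N \<Longrightarrow> y l \<in> {0..1}" and e: "0 \<le> e" "e \<le> 1 / (2 * (2 * p + 3))"
  shows "\<bar>log_jacobian N a b \<beta> p y e\<bar> \<le> e * loop_bound N a b \<beta> p"
proof -
  let ?B = "2 * real p + 3"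
  have ln: "\<bar>ln (1 + e * q)\<bar> \<le> 2 * e * ?B" if "\<bar>q\<bar> \<le> ?B" for q
  proof -
    have "\<bar>e * q\<bar> \<le> e * ?B" using e(1) that by (simp add: abs_mult mult_left_mono)
    moreover have "e * ?B \<le> 1 / 2" using e(2) by (simp add: field_simps)
    ultimately show ?thesis using abs_ln_one_plus_le [of "e * q"] by linarith
  qed
  have b1: "\<bar>y l ^ p - y l ^ Suc p\<bar> \<le> ?B" "\<bar>- (y l ^ Suc p)\<bar> \<le> ?B" if "l < N" for l
  proof -
    have "0 \<le> y l ^ p" "y l ^ p \<le> 1" "0 \<le> y l ^ Suc p" "y l ^ Suc p \<le> 1"
      using y [OF that] by (auto intro!: power_le_one simp del: power_Suc)
    then show "\<bar>y l ^ p - y l ^ Suc p\<bar> \<le> ?B" "\<bar>- (y l ^ Suc p)\<bar> \<le> ?B" by linarith+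
  qed
  have "\<bar>log_jacobian N a b \<beta> p y e\<bar> \<le>
      (\<Sum>l<N. \<bar>a\<bar> * (2 * e * ?B) + \<bar>b\<bar> * (2 * e * ?B) + 2 * e * ?B) + (\<Sum>k<N. \<Sum>j<N. \<bar>\<beta>\<bar> * (2 * e * ?B))"
    unfolding log_jacobian_def
  proof (intro order.trans [OF abs_triangle_ineq] add_mono)
    show "\<bar>\<Sum>l<N. a * ln (1 + e * (y l ^ p - y l ^ Suc p)) + b * ln (1 + e * (- (y l ^ Suc p)))
            + ln (1 + e * vfield_deriv p (y l))\<bar> \<le> (\<Sum>l<N. \<bar>a\<bar> * (2 * e * ?B) + \<bar>b\<bar> * (2 * e * ?B) + 2 * e * ?B)"
    proof (intro order.trans [OF sum_abs] sum_mono order.trans [OF abs_triangle_ineq] add_mono)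
      fix l assume "l \<in> {..<N}"
      then have l: "l < N" by simp
      show "\<bar>a * ln (1 + e * (y l ^ p - y l ^ Suc p))\<bar> \<le> \<bar>a\<bar> * (2 * e * ?B)"
           "\<bar>b * ln (1 + e * (- (y l ^ Suc p)))\<bar> \<le> \<bar>b\<bar> * (2 * e * ?B)"
        unfolding abs_mult by (intro mult_left_mono ln b1 l abs_ge_zero)+
      show "\<bar>ln (1 + e * vfield_deriv p (y l))\<bar> \<le> 2 * e * ?B"
        using abs_vfield_deriv_le [OF y [OF l], of p] by (intro ln) auto
    qed
    show "\<bar>\<Sum>k<N. \<Sum>j<k. \<beta> * ln (1 + e * vfield_dd p (y k) (y j))\<bar> \<le> (\<Sum>k<N. \<Sum>j<N. \<bar>\<beta>\<bar> * (2 * e * ?B))"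
    proof (intro order.trans [OF sum_abs] sum_mono)
      fix k assume k: "k \<in> {..<N}"
      have "(\<Sum>j<k. \<bar>\<beta> * ln (1 + e * vfield_dd p (y k) (y j))\<bar>) \<le> (\<Sum>j<k. \<bar>\<beta>\<bar> * (2 * e * ?B))"
        unfolding abs_mult using k abs_vfield_dd_le [OF y y, of k _ p]
        by (intro sum_mono mult_left_mono ln) auto
      also have "\<dots> \<le> (\<Sum>j<N. \<bar>\<beta>\<bar> * (2 * e * ?B))"
        using k e(1) by (intro sum_mono2) auto
      finally show "(\<Sum>j<k. \<bar>\<beta> * ln (1 + e * vfield_dd p (y k) (y j))\<bar>) \<le> (\<Sum>j<N. \<bar>\<beta>\<bar> * (2 * e * ?B))" .
    qed
  qed
  also have "\<dots> = e * loop_bound N a b \<beta> p"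
    by (simp add: loop_bound_def algebra_simps)
  finally show ?thesis .
qed

text \<open>For such e all stretching factors are positive, so each \<open>powr\<close> splits into
  its old value and an exponential, whatever the sign of its exponent.\<close>

lemma jacobi_weight_subst:
  fixes e :: real
  assumes cube: "\<And>l. l < N \<Longrightarrow> 0 < y l \<and> y l < 1"
    and e: "0 \<le> e" "e \<le> 1 / (2 * (2 * p + 3))"
  shows "(\<Prod>l<N. 1 + e * vfield_deriv p (y l)) *
      jacobi_weight N a b \<beta> (\<lambda>l\<in>{..<N}. y l + e * vfield p (y l))
    = jacobi_weight N a b \<beta> y * exp (log_jacobian N a b \<beta> p y e)"
proof -
  let ?B = "2 * real p + 3"
  have gt: "0 < 1 + e * q" if "\<bar>q\<bar> \<le> ?B" for q
  proof -
    have "\<bar>e * q\<bar> \<le> e * ?B" using e(1) that by (simp add: abs_mult mult_left_mono)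
    moreover have "e * ?B \<le> 1 / 2" using e(2) by (simp add: field_simps)
    ultimately show ?thesis by linarith
  qed
  let ?T = "\<lambda>l. y l + e * vfield p (y l)"
  define q1 q2 where "q1 l = 1 + e * (y l ^ p - y l ^ Suc p)" and "q2 l = 1 + e * (- (y l ^ Suc p))" for l
  have pos: "0 < q1 l" "0 < q2 l" "0 < 1 + e * vfield_deriv p (y l)" if "l < N" for l
  proof -
    have "0 \<le> y l ^ p" "y l ^ p \<le> 1" "0 \<le> y l ^ Suc p" "y l ^ Suc p \<le> 1"
      using cube [OF that] by (auto intro!: power_le_one simp del: power_Suc)
    then show "0 < q1 l" "0 < q2 l" unfolding q1_def q2_def by (intro gt; linarith)+
    show "0 < 1 + e * vfield_deriv p (y l)"
      using abs_vfield_deriv_le [of "y l" p] cube [OF that] by (intro gt) auto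
  qed
  have T1: "?T l = y l * q1 l" and T2: "1 - ?T l = (1 - y l) * q2 l" for l
    by (simp_all add: q1_def q2_def vfield_def algebra_simps)
  have cubeT: "0 < ?T l \<and> ?T l < 1" if "l < N" for l
  proof -
    have "0 < y l * q1 l" "0 < (1 - y l) * q2 l" using cube [OF that] pos [OF that] by auto
    then show ?thesis using T1 [of l] T2 [of l] by linarith
  qed
  have bw: "(1 + e * vfield_deriv p (y l)) * beta_weight a b (?T l) =
      beta_weight a b (y l) * exp (a * ln (q1 l) + b * ln (q2 l) + ln (1 + e * vfield_deriv p (y l)))"
    if "l < N" for l
  proof -
    have "beta_weight a b (?T l) = ?T l powr a * (1 - ?T l) powr b"
      using cubeT [OF that] by (simp add: beta_weight_def)
    also have "\<dots> = (y l * q1 l) powr a * ((1 - y l) * q2 l) powr b"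
      unfolding T2 unfolding T1 ..
    finally show ?thesis
      using cube [OF that] pos [OF that]
      by (simp add: beta_weight_def powr_mult) (simp add: powr_def exp_add)
  qed
  have dist: "\<bar>?T k - ?T j\<bar> powr \<beta> = \<bar>y k - y j\<bar> powr \<beta> * exp (\<beta> * ln (1 + e * vfield_dd p (y k) (y j)))"
    if "k < N" "j < N" for k j
  proof -
    have g: "0 < 1 + e * vfield_dd p (y k) (y j)"
      using abs_vfield_dd_le [of "y k" "y j" p] cube that by (intro gt) (auto simp: less_imp_le)
    have "?T k - ?T j = (y k - y j) + e * (vfield p (y k) - vfield p (y j))" by (simp add: algebra_simps)
    also have "\<dots> = (y k - y j) * (1 + e * vfield_dd p (y k) (y j))"
      by (simp add: vfield_diff algebra_simps)
    finally show ?thesis using g by (simp add: abs_mult powr_mult) (simp add: powr_def)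
  qed
  have "(\<Prod>l<N. 1 + e * vfield_deriv p (y l)) * jacobi_weight N a b \<beta> (\<lambda>l\<in>{..<N}. ?T l)
     = (\<Prod>l<N. (1 + e * vfield_deriv p (y l)) * beta_weight a b (?T l)) * (\<Prod>k<N. \<Prod>j<k. \<bar>?T k - ?T j\<bar> powr \<beta>)"
    unfolding jacobi_weight_eq by (simp add: prod.distrib)
  also have "(\<Prod>l<N. (1 + e * vfield_deriv p (y l)) * beta_weight a b (?T l)) =
     (\<Prod>l<N. beta_weight a b (y l)) *
     exp (\<Sum>l<N. a * ln (q1 l) + b * ln (q2 l) + ln (1 + e * vfield_deriv p (y l)))"
    using bw by (simp add: exp_sum prod.distrib [symmetric])
  also have "(\<Prod>k<N. \<Prod>j<k. \<bar>?T k - ?T j\<bar> powr \<beta>) = (\<Prod>k<N. \<Prod>j<k. \<bar>y k - y j\<bar> powr \<beta>) *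
     exp (\<Sum>k<N. \<Sum>j<k. \<beta> * ln (1 + e * vfield_dd p (y k) (y j)))"
    using dist by (simp add: exp_sum prod.distrib [symmetric])
  finally show ?thesis
    unfolding jacobi_weight_eq log_jacobian_def q1_def q2_def by (simp add: exp_add)
qed

lemma borel_measurable_vfield_dd:
  assumes "k < N" "j < N"
  shows "(\<lambda>y. vfield_dd p (y k) (y j)) \<in> borel_measurable (lborel_PiM N)"
  using assms unfolding vfield_dd_def pow_dd_def
  by (intro borel_measurable_sum borel_measurable_times borel_measurable_diff borel_measurable_power
      borel_measurable_PiM_component) auto

lemma borel_measurable_loop_sum [measurable]:
  "loop_sum N a b \<beta> p \<in> borel_measurable (lborel_PiM N)"
  unfolding loop_sum_def [abs_def] vfield_deriv_def
  by (intro borel_measurable_sum borel_measurable_add borel_measurable_times borel_measurable_diff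
      borel_measurable_uminus borel_measurable_const borel_measurable_power
      borel_measurable_PiM_component borel_measurable_vfield_dd) auto

lemma jacobi_weight_eq_0: "\<not> (\<forall>l<N. 0 < y l \<and> y l < 1) \<Longrightarrow> jacobi_weight N a b \<beta> y = 0"
  by (simp only: jacobi_weight_def if_False)

text \<open>The total mass is independent of e, since the substitution maps the cube onto itself.
  The loop equation is the derivative of this conservation law.\<close>

lemma integral_jacobi_weight_subst:
  fixes e :: real
  assumes int: "integrable (lborel_PiM N) (jacobi_weight N a b \<beta>)"
    and e: "0 \<le> e" "e \<le> 1 / (2 * (2 * p + 3))"
  shows "has_bochner_integral (lborel_PiM N)
     (\<lambda>y. jacobi_weight N a b \<beta> y * exp (log_jacobian N a b \<beta> p y e))
     (\<integral>y. jacobi_weight N a b \<beta> y \<partial>lborel_PiM N)"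
proof -
  let ?w = "jacobi_weight N a b \<beta>" and ?M = "lborel_PiM N" and ?B = "2 * real p + 3"
  define T where "T t = t + e * vfield p t" for t
  define g where "g t = indicator {0..1} t * (1 + e * vfield_deriv p t)" for t
  have g_pos: "0 \<le> 1 + e * vfield_deriv p t" if "t \<in> {0..1}" for t
  proof -
    have "\<bar>e * vfield_deriv p t\<bar> \<le> e * ?B"
      using e(1) abs_vfield_deriv_le [OF that, of p] by (simp add: abs_mult mult_left_mono)
    moreover have "e * ?B \<le> 1 / 2" using e(2) by (simp add: field_simps)
    ultimately show ?thesis by linarith
  qed
  have [measurable]: "T \<in> borel_measurable borel" "g \<in> borel_measurable borel"
    unfolding T_def g_def vfield_def vfield_deriv_def by measurable
  have sub: "(\<integral>\<^sup>+t. ennreal (g t) * indicator A (T t) \<partial>lborel)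
      = (\<integral>\<^sup>+t. indicator {0..1} t * indicator A t \<partial>lborel)" if [measurable]: "A \<in> sets borel" for A
  proof -
    have T01: "T 0 = 0" "T 1 = 1" by (simp_all add: T_def vfield_def)
    have "(\<integral>\<^sup>+t. ennreal (indicat_real A t * indicator {T 0..T 1} t) \<partial>lborel)
      = (\<integral>\<^sup>+t. ennreal (indicator A (T t) * (1 + e * vfield_deriv p t) * indicator {0..1} t) \<partial>lborel)"
    proof (rule nn_integral_substitution)
      show "(T has_real_derivative 1 + e * vfield_deriv p t) (at t)" for t
        unfolding T_def vfield_def vfield_deriv_def
        using DERIV_pow [of "Suc p" t] DERIV_pow [of "Suc (Suc p)" t]
        by (intro DERIV_add DERIV_ident DERIV_cmult DERIV_diff) (simp_all del: power_Suc of_nat_Suc)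
      show "continuous_on {0..1} (\<lambda>t. 1 + e * vfield_deriv p t)"
        unfolding vfield_deriv_def by (intro continuous_intros)
    qed (use g_pos in \<open>auto simp: set_borel_measurable_def\<close>)
    moreover have "ennreal (indicat_real A t * indicator {T 0..T 1} t) = indicator {0..1} t * indicator A t" for t
      by (simp add: T01 indicator_def)
    moreover have "ennreal (indicator A (T t) * (1 + e * vfield_deriv p t) * indicator {0..1} t)
        = ennreal (g t) * indicator A (T t)" for t
      by (simp add: g_def indicator_def)
    ultimately show ?thesis by simp
  qed
  have eq: "(\<Prod>l<N. ennreal (g (y l))) * ennreal (?w (\<lambda>l\<in>{..<N}. T (y l)))
      = ennreal (?w y * exp (log_jacobian N a b \<beta> p y e))" for y
  proof (cases "\<forall>l<N. 0 < y l \<and> y l < 1")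
    case True
    then have gy: "(\<Prod>l<N. g (y l)) = (\<Prod>l<N. 1 + e * vfield_deriv p (y l))"
      by (intro prod.cong) (auto simp: g_def less_imp_le)
    have "(\<Prod>l<N. ennreal (g (y l))) = ennreal (\<Prod>l<N. g (y l))"
      using True g_pos by (intro prod_ennreal) (auto simp: g_def less_imp_le)
    then show ?thesis
      using jacobi_weight_subst [of N y e p a b \<beta>] True e
      by (simp add: ennreal_mult'' [symmetric] jacobi_weight_nonneg gy T_def)
  next
    case False
    then obtain l where l: "l < N" "y l \<notin> {0<..<1}" by auto
    have "(\<Prod>l<N. ennreal (g (y l))) * ennreal (?w (\<lambda>l\<in>{..<N}. T (y l))) = 0"
    \<comment> \<open>A coordinate equal to 0 or 1 is fixed by T, so the weight at the image
      vanishes; a coordinate outside [0,1] is annihilated by g.\<close>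
    proof (cases "y l \<in> {0..1}")
      case True
      then have "y l = 0 \<or> y l = 1" using l by auto
      then have "T (y l) \<notin> {0<..<1}" by (auto simp: T_def vfield_def)
      then have "?w (\<lambda>l\<in>{..<N}. T (y l)) = 0" using l(1) by (intro jacobi_weight_eq_0) auto
      then show ?thesis by simp
    next
      case False
      then have "(\<Prod>l<N. ennreal (g (y l))) = 0"
        using l(1) by (intro prod_zero bexI [of _ l]) (auto simp: g_def)
      then show ?thesis by simp
    qed
    then show ?thesis using jacobi_weight_eq_0 [OF False] by simp
  qed
  have Tm: "(\<lambda>y. \<lambda>l\<in>{..<N}. T (y l)) \<in> measurable ?M ?M"
    by (intro measurable_restrict) (auto intro!: measurable_compose [OF borel_measurable_PiM_component])
  \<comment> \<open>Measurability is read off from \<open>eq\<close>, whose left side is composed of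
    measurable pieces.\<close>
  have meas: "(\<lambda>y. ?w y * exp (log_jacobian N a b \<beta> p y e)) \<in> borel_measurable ?M"
  proof -
    have "(\<lambda>y. ?w y * exp (log_jacobian N a b \<beta> p y e)) =
        (\<lambda>y. enn2real ((\<Prod>l<N. ennreal (g (y l))) * ennreal (?w (\<lambda>l\<in>{..<N}. T (y l)))))"
      by (simp add: eq jacobi_weight_nonneg)
    also have "\<dots> \<in> borel_measurable ?M"
      by (intro borel_measurable_enn2real borel_measurable_times_ennreal
        borel_measurable_prod_ennreal measurable_compose [OF _ measurable_ennreal]
        measurable_compose [OF Tm borel_measurable_jacobi_weight]
        measurable_compose [OF borel_measurable_PiM_component \<open>g \<in> borel_measurable borel\<close>])
    finally show ?thesis .
  qed
  have "(\<integral>\<^sup>+y. ennreal (?w y * exp (log_jacobian N a b \<beta> p y e)) \<partial>?M)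
      = (\<integral>\<^sup>+y. (\<Prod>l<N. indicator {0..1} (y l)) * ennreal (?w y) \<partial>?M)"
    unfolding eq [symmetric] using sub
    by (intro nn_integral_PiM_substitution) auto
  also have "\<dots> = (\<integral>\<^sup>+y. ennreal (?w y) \<partial>?M)"
  proof (intro nn_integral_cong)
    fix y
    show "(\<Prod>l<N. indicator {0..1} (y l)) * ennreal (?w y) = ennreal (?w y)"
    proof (cases "\<forall>l<N. 0 < y l \<and> y l < 1")
      case True
      then have "(\<Prod>l<N. indicator {0..1} (y l) :: ennreal) = 1"
        by (intro prod.neutral) (auto simp: less_imp_le)
      then show ?thesis by simp
    qed (simp add: jacobi_weight_eq_0)
  qed
  also have "\<dots> = ennreal (\<integral>y. ?w y \<partial>?M)"
    using int by (intro nn_integral_eq_integral) (auto simp: jacobi_weight_nonneg)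
  finally show ?thesis
    using meas by (intro has_bochner_integral_nn_integral) (auto simp: jacobi_weight_nonneg)
qed

text \<open>All difference quotients in e have integral 0. They are dominated by a constant multiple
  of the weight, so their pointwise limit, the weight times \<open>loop_sum\<close>, has integral 0
  as well.\<close>

lemma jacobi_loop_equation:
  assumes int: "integrable (lborel_PiM N) (jacobi_weight N a b \<beta>)"
  shows "(\<integral>y. jacobi_weight N a b \<beta> y * loop_sum N a b \<beta> p y \<partial>lborel_PiM N) = 0"
proof -
  let ?w = "jacobi_weight N a b \<beta>" and ?M = "lborel_PiM N"
  define e where "e n = (1 / (2 * (2 * real p + 3))) / real (Suc n)" for n
  have e: "0 < e n" "e n \<le> 1 / (2 * (2 * real p + 3))" "e n \<le> 1" for n
  proof -
    let ?c = "1 / (2 * (2 * real p + 3))"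
    have "?c / real (Suc n) \<le> ?c / 1" by (intro divide_left_mono) auto
    moreover have "?c \<le> 1" by simp
    ultimately show "e n \<le> ?c" "e n \<le> 1" unfolding e_def by linarith+
    show "0 < e n" by (simp add: e_def add_pos_nonneg)
  qed
  have e_lim: "e \<longlonglongrightarrow> 0"
    unfolding e_def by (rule LIMSEQ_Suc [OF lim_const_over_n])
  let ?C = "loop_bound N a b \<beta> p"
  have C: "0 \<le> ?C" by (simp add: loop_bound_def)
  let ?f = "\<lambda>n y. ?w y * ((exp (log_jacobian N a b \<beta> p y (e n)) - 1) / e n)"
  have f: "has_bochner_integral ?M (?f n) 0" for n
  proof -
    have "has_bochner_integral ?M (\<lambda>y. (?w y * exp (log_jacobian N a b \<beta> p y (e n)) - ?w y) / e n)
       (((\<integral>y. ?w y \<partial>?M) - (\<integral>y. ?w y \<partial>?M)) / e n)"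
      using int e [of n]
      by (intro has_bochner_integral_divide_zero has_bochner_integral_diff integral_jacobi_weight_subst
          has_bochner_integral_integrable) auto
    moreover have "(?w y * exp (log_jacobian N a b \<beta> p y (e n)) - ?w y) / e n = ?f n y" for y
      by (simp add: algebra_simps diff_divide_distrib)
    ultimately show ?thesis by simp
  qed
  have bound: "\<bar>?f n y\<bar> \<le> ?w y * (?C * exp ?C)" for n y
  proof (cases "\<forall>l<N. 0 < y l \<and> y l < 1")
    case True
    let ?S = "log_jacobian N a b \<beta> p y (e n)"
    have S: "\<bar>?S\<bar> \<le> e n * ?C"
      using True e [of n] by (intro abs_log_jacobian_le) (auto simp: less_imp_le)
    also have "\<dots> \<le> 1 * ?C" using e C by (intro mult_right_mono) auto
    finally have S': "\<bar>?S\<bar> \<le> ?C" by simp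
    have "\<bar>exp ?S - 1\<bar> \<le> \<bar>?S\<bar> * exp \<bar>?S\<bar>" by (rule abs_exp_minus_one_le)
    also have "\<dots> \<le> (e n * ?C) * exp ?C" using S S' C e [of n] by (intro mult_mono) auto
    finally have "\<bar>exp ?S - 1\<bar> / e n \<le> ?C * exp ?C" using e [of n] by (simp add: field_simps)
    then have "?w y * (\<bar>exp ?S - 1\<bar> / e n) \<le> ?w y * (?C * exp ?C)"
      by (rule mult_left_mono) (rule jacobi_weight_nonneg)
    then show ?thesis using e [of n] by (simp add: abs_mult jacobi_weight_nonneg)
  qed (simp add: jacobi_weight_eq_0)
  have lim: "(\<lambda>n. ?f n y) \<longlonglongrightarrow> ?w y * loop_sum N a b \<beta> p y" for y
  proof -
    have "((\<lambda>h. (exp (log_jacobian N a b \<beta> p y h) - 1) / h) \<longlongrightarrow> loop_sum N a b \<beta> p y) (at 0)"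
      using log_jacobian_DERIV [of N a b \<beta> p y] by (simp add: DERIV_def log_jacobian_0)
    moreover have "filterlim e (at 0) sequentially"
      using e_lim e by (auto simp: filterlim_at intro!: always_eventually) (metis less_irrefl)
    ultimately have "(\<lambda>n. (exp (log_jacobian N a b \<beta> p y (e n)) - 1) / e n) \<longlonglongrightarrow> loop_sum N a b \<beta> p y"
      by (rule filterlim_compose)
    then show ?thesis by (rule tendsto_mult_left)
  qed
  have "(\<lambda>n. integral\<^sup>L ?M (?f n)) \<longlonglongrightarrow> (\<integral>y. ?w y * loop_sum N a b \<beta> p y \<partial>?M)"
  proof (rule integral_dominated_convergence)
    show "integrable ?M (\<lambda>y. ?w y * (?C * exp ?C))" using int by simp
    show "?f n \<in> borel_measurable ?M" for n
      using f [of n] by (rule borel_measurable_has_bochner_integral)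
    show "AE y in ?M. norm (?f n y) \<le> ?w y * (?C * exp ?C)" for n
      using bound by simp
  qed (use lim in auto)
  moreover have "integral\<^sup>L ?M (?f n) = 0" for n
    using f by (rule has_bochner_integral_integral_eq)
  ultimately have "(\<lambda>n. 0) \<longlonglongrightarrow> (\<integral>y. ?w y * loop_sum N a b \<beta> p y \<partial>?M)"
    by (simp only:)
  from LIMSEQ_unique [OF this tendsto_const] show ?thesis .
qed

section \<open>The loop sum in terms of power sums\<close>

definition power_sum :: "nat \<Rightarrow> nat \<Rightarrow> (nat \<Rightarrow> real) \<Rightarrow> real" where
  "power_sum N p y = (\<Sum>j<N. y j ^ p)"

lemma pow_dd_commute: "pow_dd n x y = pow_dd n y x"
proof -
  have "pow_dd n x y = (\<Sum>i<n. (\<lambda>i. x ^ (n - Suc i) * y ^ i) (n - Suc i))"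
    unfolding pow_dd_def by (intro sum.cong refl) simp
  also have "\<dots> = pow_dd n y x"
    unfolding pow_dd_def by (rule sum.nat_diff_reindex)
  finally show ?thesis .
qed

lemma vfield_dd_commute: "vfield_dd p x y = vfield_dd p y x"
  unfolding vfield_dd_def by (simp only: pow_dd_commute)

lemma pow_dd_diag: "pow_dd (Suc n) x x = real (Suc n) * x ^ n"
proof -
  have "x ^ (Suc n - Suc i) * x ^ i = x ^ n" if "i < Suc n" for i
    using that by (simp add: power_add [symmetric])
  then show ?thesis unfolding pow_dd_def by simp
qed

lemma vfield_dd_diag: "vfield_dd p x x = vfield_deriv p x"
  unfolding vfield_dd_def vfield_deriv_def pow_dd_diag ..

lemma sum_lessThan_pairs:
  fixes d :: "nat \<Rightarrow> nat \<Rightarrow> real"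
  assumes "\<And>k j. d k j = d j k"
  shows "2 * (\<Sum>k<n. \<Sum>j<k. d k j) = (\<Sum>k<n. \<Sum>j<n. d k j) - (\<Sum>k<n. d k k)"
proof (induction n)
  case (Suc n)
  have "(\<Sum>k<n. d n k) = (\<Sum>k<n. d k n)" using assms by simp
  with Suc show ?case by (simp add: sum.distrib)
qed simp

text \<open>The summands are monomials in y k times monomials in y j, so the sum over all ordered
  pairs factorises. This needs the diagonal k = j to be included.\<close>

lemma sum_pow_dd:
  "(\<Sum>k<N. \<Sum>j<N. pow_dd n (y k) (y j)) = (\<Sum>i<n. power_sum N i y * power_sum N (n - Suc i) y)"
proof -
  have "(\<Sum>k<N. \<Sum>j<N. pow_dd n (y k) (y j)) = (\<Sum>k<N. \<Sum>i<n. \<Sum>j<N. y j ^ (n - Suc i) * y k ^ i)"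
    unfolding pow_dd_def by (intro sum.cong refl sum.swap)
  also have "\<dots> = (\<Sum>i<n. \<Sum>k<N. \<Sum>j<N. y j ^ (n - Suc i) * y k ^ i)"
    by (rule sum.swap)
  also have "\<dots> = (\<Sum>i<n. power_sum N i y * power_sum N (n - Suc i) y)"
    unfolding power_sum_def by (simp add: sum_product mult.commute)
  finally show ?thesis .
qed

text \<open>Completing the sum over j < k to the full square adds half the diagonal, where
  \<open>vfield_dd\<close> equals \<open>vfield_deriv\<close>. Subtracting it again lowers the
  coefficient of the Jacobian term from 1 to 1 - \<beta>/2.\<close>

lemma loop_sum_eq:
  "loop_sum N a b \<beta> p y =
     (1 - \<beta> / 2) * (real (Suc p) * power_sum N p y - real (Suc (Suc p)) * power_sum N (Suc p) y)
     + a * (power_sum N p y - power_sum N (Suc p) y) - b * power_sum N (Suc p) y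
     + (\<beta> / 2) * ((\<Sum>i<Suc p. power_sum N i y * power_sum N (p - i) y)
                - (\<Sum>i<Suc (Suc p). power_sum N i y * power_sum N (Suc p - i) y))"
proof -
  have "(\<Sum>k<N. \<Sum>j<k. \<beta> * vfield_dd p (y k) (y j)) = (\<beta> / 2) * (2 * (\<Sum>k<N. \<Sum>j<k. vfield_dd p (y k) (y j)))"
    by (simp add: sum_distrib_left)
  also have "\<dots> = (\<beta> / 2) * ((\<Sum>k<N. \<Sum>j<N. vfield_dd p (y k) (y j)) - (\<Sum>k<N. vfield_deriv p (y k)))"
    by (subst sum_lessThan_pairs) (simp_all only: vfield_dd_commute vfield_dd_diag)
  also have "(\<Sum>k<N. \<Sum>j<N. vfield_dd p (y k) (y j)) =
      (\<Sum>i<Suc p. power_sum N i y * power_sum N (p - i) y)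
    - (\<Sum>i<Suc (Suc p). power_sum N i y * power_sum N (Suc p - i) y)"
    by (simp only: vfield_dd_def sum_subtractf sum_pow_dd diff_Suc_Suc)
  finally have pairs: "(\<Sum>k<N. \<Sum>j<k. \<beta> * vfield_dd p (y k) (y j)) = (\<beta> / 2) *
     ((\<Sum>i<Suc p. power_sum N i y * power_sum N (p - i) y)
    - (\<Sum>i<Suc (Suc p). power_sum N i y * power_sum N (Suc p - i) y) - (\<Sum>k<N. vfield_deriv p (y k)))" .
  have deriv: "(\<Sum>k<N. vfield_deriv p (y k)) =
      real (Suc p) * power_sum N p y - real (Suc (Suc p)) * power_sum N (Suc p) y"
    by (simp only: vfield_deriv_def power_sum_def sum_subtractf sum_distrib_left)
  have one: "(\<Sum>l<N. a * (y l ^ p - y l ^ Suc p) + b * (- (y l ^ Suc p)) + vfield_deriv p (y l))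
     = a * (power_sum N p y - power_sum N (Suc p) y) - b * power_sum N (Suc p) y
      + (\<Sum>k<N. vfield_deriv p (y k))"
    by (simp add: power_sum_def sum.distrib sum_subtractf sum_distrib_left sum_negf right_diff_distrib del: power_Suc)
  show ?thesis unfolding loop_sum_def pairs one deriv by (simp only: left_diff_distrib right_diff_distrib mult_1)
qed

section \<open>Cumulants and limiting moments\<close>

lemma partition_on_singleton_iff: "partition_on {x} P \<longleftrightarrow> P = {{x}}"
proof
  assume P: "partition_on {x} P"
  then have "\<Union>P = {x}" "{} \<notin> P" by (auto simp: partition_on_def)
  then have "\<forall>B\<in>P. B = {x}" by (metis Sup_upper subset_singletonD)
  with \<open>\<Union>P = {x}\<close> show "P = {{x}}" by auto
qed (auto simp: partition_on_def disjoint_def)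

lemma partition_on_pair_iff:
  assumes "x \<noteq> y"
  shows "partition_on {x, y} P \<longleftrightarrow> P = {{x, y}} \<or> P = {{x}, {y}}"
proof
  assume P: "partition_on {x, y} P"
  then have U: "\<Union>P = {x, y}" and ne: "{} \<notin> P" and d: "\<And>A B. A \<in> P \<Longrightarrow> B \<in> P \<Longrightarrow> A \<noteq> B \<Longrightarrow> A \<inter> B = {}"
    by (auto simp: partition_on_def disjoint_def)
  have B: "B = {x} \<or> B = {y} \<or> B = {x, y}" if "B \<in> P" for B
  proof -
    have "B \<subseteq> {x, y}" "B \<noteq> {}" using that U ne by auto
    then show ?thesis by auto
  qed
  show "P = {{x, y}} \<or> P = {{x}, {y}}"
  proof (cases "{x, y} \<in> P")
    case True
    have "P \<subseteq> {{x, y}}"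
    proof
      fix B assume "B \<in> P"
      then show "B \<in> {{x, y}}" using d [OF True \<open>B \<in> P\<close>] B [OF \<open>B \<in> P\<close>] by fastforce
    qed
    with True have "P = {{x, y}}" by blast
    then show ?thesis ..
  next
    case False
    obtain Bx where "Bx \<in> P" "x \<in> Bx" using U by blast
    with B [of Bx] False assms have x: "{x} \<in> P" by auto
    obtain By where "By \<in> P" "y \<in> By" using U by blast
    with B [of By] False assms have y: "{y} \<in> P" by auto
    have "P \<subseteq> {{x}, {y}}"
    proof
      fix B assume "B \<in> P"
      then show "B \<in> {{x}, {y}}" using B [OF \<open>B \<in> P\<close>] False by blast
    qed
    with x y have "P = {{x}, {y}}" by blast
    then show ?thesis ..
  qed
qed (use assms in \<open>auto simp: partition_on_def disjoint_def\<close>)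

lemma joint_cumulant_1: "joint_cumulant M 1 X = (\<integral>\<omega>. X 0 \<omega> \<partial>M)"
proof -
  have "{P. partition_on {..<1::nat} P} = {{{0}}}"
    using partition_on_singleton_iff [of "0::nat"] by (auto simp: lessThan_Suc)
  then show ?thesis by (simp add: joint_cumulant_def)
qed

lemma joint_cumulant_2:
  "joint_cumulant M 2 X = (\<integral>\<omega>. X 0 \<omega> * X 1 \<omega> \<partial>M) - (\<integral>\<omega>. X 0 \<omega> \<partial>M) * (\<integral>\<omega>. X 1 \<omega> \<partial>M)"
proof -
  have "{..<2::nat} = {0, 1}" by auto
  then have *: "{P. partition_on {..<2::nat} P} = {{{0, 1}}, {{0}, {1}}}"
    using partition_on_pair_iff [of "0::nat" 1] by auto
  have ne: "{{0, 1}} \<noteq> {{0}, {1::nat}}" by (auto simp: doubleton_eq_iff)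
  then show ?thesis unfolding joint_cumulant_def * by simp
qed

section \<open>Expectations of power sums at finite N\<close>

locale jacobi_params =
  fixes a b \<alpha> :: real
  assumes a_gt: "a > -1" and b_gt: "b > -1" and \<alpha>_gt: "\<alpha> > - min 1 (min (1 + a) (1 + b))"
begin

abbreviation \<E> :: "nat \<Rightarrow> (nat \<Rightarrow> real) measure" where
  "\<E> N \<equiv> jacobi_ensemble N a b (2 * \<alpha> / real N)"

lemma sets_ensemble [measurable_cong]: "sets (\<E> N) = sets (lborel_PiM N)"
  by (simp add: jacobi_ensemble_def)

lemma AE_ensemble:
  assumes "0 < N"
  shows "AE y in \<E> N. \<forall>l<N. 0 < y l \<and> y l < 1"
  unfolding jacobi_ensemble_def
  by (subst AE_density) (auto intro!: AE_I2 simp: jacobi_weight_def split: if_splits)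

text \<open>The density vanishes off the open cube, so a bound there holds almost everywhere; total
  mass 1 lets the same constant bound the integral.\<close>

lemma
  fixes F :: "(nat \<Rightarrow> real) \<Rightarrow> 'b::{banach, second_countable_topology}"
  assumes N: "0 < N" and F: "F \<in> borel_measurable (lborel_PiM N)"
    and bound: "\<And>y. (\<forall>l<N. 0 < y l \<and> y l < 1) \<Longrightarrow> norm (F y) \<le> C"
  shows integrable_ensemble: "integrable (\<E> N) F"
    and norm_integral_ensemble_le: "norm (\<integral>y. F y \<partial>\<E> N) \<le> C"
proof -
  have space: "emeasure (\<E> N) (space (\<E> N)) = 1"
    using emeasure_jacobi_ensemble_space [OF a_gt b_gt \<alpha>_gt N] .
  then interpret finite_measure "\<E> N" by (intro finite_measureI) simp
  have F [measurable]: "F \<in> borel_measurable (\<E> N)" using F by measurable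
  have ae: "AE y in \<E> N. norm (F y) \<le> C"
    using AE_ensemble [OF N] by eventually_elim (rule bound)
  show int: "integrable (\<E> N) F" using ae F by (rule integrable_const_bound)
  have "norm (\<integral>y. F y \<partial>\<E> N) \<le> (\<integral>y. norm (F y) \<partial>\<E> N)" by (rule integral_norm_bound)
  also have "\<dots> \<le> (\<integral>y. C \<partial>\<E> N)"
    using int ae by (intro integral_mono_AE) auto
  also have "\<dots> = C" using space by (simp add: measure_def)
  finally show "norm (\<integral>y. F y \<partial>\<E> N) \<le> C" .
qed

lemma borel_measurable_power_sum [measurable]: "power_sum N p \<in> borel_measurable (lborel_PiM N)"
  unfolding power_sum_def [abs_def]
  by (intro borel_measurable_sum borel_measurable_power borel_measurable_PiM_component) auto

lemma abs_power_sum_le: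
  assumes "\<forall>l<N. 0 < y l \<and> y l < 1"
  shows "\<bar>power_sum N p y\<bar> \<le> N"
proof -
  have "\<bar>power_sum N p y\<bar> \<le> (\<Sum>j<N. \<bar>y j ^ p\<bar>)" unfolding power_sum_def by (rule sum_abs)
  also have "\<dots> \<le> (\<Sum>j<N. 1)"
    using assms by (intro sum_mono) (auto simp: power_abs less_imp_le intro!: power_le_one)
  finally show ?thesis by simp
qed

lemma integrable_power_sum: "0 < N \<Longrightarrow> integrable (\<E> N) (power_sum N p)"
  using abs_power_sum_le by (intro integrable_ensemble) auto

lemma integrable_power_sum_mult:
  "0 < N \<Longrightarrow> integrable (\<E> N) (\<lambda>y. power_sum N p y * power_sum N q y)"
  by (rule integrable_ensemble [where C = "real N * real N"])
     (auto simp: abs_mult intro!: mult_mono abs_power_sum_le)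

definition mean :: "nat \<Rightarrow> nat \<Rightarrow> real" where
  "mean N p = (\<integral>y. power_sum N p y \<partial>\<E> N)"

definition mean2 :: "nat \<Rightarrow> nat \<Rightarrow> nat \<Rightarrow> real" where
  "mean2 N p q = (\<integral>y. power_sum N p y * power_sum N q y \<partial>\<E> N)"

lemma mean_loop_equation:
  assumes N: "0 < N"
  shows "(1 - \<alpha> / N) * (real (Suc p) * mean N p - real (Suc (Suc p)) * mean N (Suc p))
     + a * (mean N p - mean N (Suc p)) - b * mean N (Suc p)
     + (\<alpha> / N) * ((\<Sum>i<Suc p. mean2 N i (p - i)) - (\<Sum>i<Suc (Suc p). mean2 N i (Suc p - i))) = 0"
proof -
  let ?\<beta> = "2 * \<alpha> / real N"
  let ?w = "jacobi_weight N a b ?\<beta>" and ?Z = "jacobi_partition N a b ?\<beta>"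
  have Z: "0 < ?Z" by (rule jacobi_partition_pos [OF a_gt b_gt \<alpha>_gt N])
  have "(\<integral>y. loop_sum N a b ?\<beta> p y \<partial>\<E> N) = (\<integral>y. ?w y / ?Z * loop_sum N a b ?\<beta> p y \<partial>lborel_PiM N)"
    unfolding jacobi_ensemble_def using Z
    by (subst integral_density) (auto simp: jacobi_weight_nonneg)
  also have "\<dots> = (\<integral>y. ?w y * loop_sum N a b ?\<beta> p y / ?Z \<partial>lborel_PiM N)" by simp
  also have "\<dots> = 0"
    using jacobi_loop_equation [OF integrable_jacobi_weight [OF a_gt b_gt \<alpha>_gt N], of p]
    by (subst integral_divide_zero) simp
  finally have "(\<integral>y. loop_sum N a b ?\<beta> p y \<partial>\<E> N) = 0" .
  moreover have "?\<beta> / 2 = \<alpha> / N" by simp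
  ultimately show ?thesis
    unfolding loop_sum_eq mean_def mean2_def
    using integrable_power_sum [OF N] integrable_power_sum_mult [OF N]
    by (simp del: sum.lessThan_Suc of_nat_Suc)
qed

end

section \<open>Limiting moments and their recursion\<close>

locale jacobi_large_N = jacobi_params +
  assumes ansatz: "large_N_ansatz a b \<alpha>"
begin

text \<open>The truncation m = 0 leaves an error o(N), so the cumulant divided by N tends to the
  leading coefficient \<open>c 0\<close>.\<close>

lemma cumulant_asymp:
  assumes "n \<ge> 1"
  shows "\<exists>c. (\<lambda>N. jacobi_cumulant a b \<alpha> n p N / N) \<longlonglongrightarrow> c"
proof -
  from ansatz assms obtain c where "\<forall>m.
      (\<lambda>N. jacobi_cumulant a b \<alpha> n p N - real N * (\<Sum>l\<le>m. c l / real N ^ l))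
          \<in> o(\<lambda>N. real N * (1 / real N ^ m))"
    unfolding large_N_ansatz_def by blast
  from spec [OF this, of 0]
  have "(\<lambda>N. jacobi_cumulant a b \<alpha> n p N - real N * c 0) \<in> o(\<lambda>N. real N)" by simp
  then have "(\<lambda>N. (jacobi_cumulant a b \<alpha> n p N - real N * c 0) / real N) \<longlonglongrightarrow> 0"
    by (rule smalloD_tendsto)
  then have "(\<lambda>N. (jacobi_cumulant a b \<alpha> n p N - real N * c 0) / real N + c 0) \<longlonglongrightarrow> 0 + c 0"
    by (intro tendsto_add tendsto_const)
  moreover have "\<forall>\<^sub>F N in sequentially. (jacobi_cumulant a b \<alpha> n p N - real N * c 0) / real N + c 0
      = jacobi_cumulant a b \<alpha> n p N / N"
    using eventually_gt_at_top [of 0] by eventually_elim (simp add: field_simps)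
  ultimately have "(\<lambda>N. jacobi_cumulant a b \<alpha> n p N / N) \<longlonglongrightarrow> c 0"
    by (simp add: tendsto_cong)
  then show ?thesis ..
qed

definition moment :: "nat \<Rightarrow> real" where
  "moment p = lim (\<lambda>N. mean N p / N)"

lemma mean_tendsto: "(\<lambda>N. mean N p / N) \<longlonglongrightarrow> moment p"
proof -
  have "jacobi_cumulant a b \<alpha> 1 (\<lambda>_. p) N = mean N p" for N
    by (simp only: jacobi_cumulant_def joint_cumulant_1 mean_def power_sum_def)
  with cumulant_asymp [of 1 "\<lambda>_. p"] have "convergent (\<lambda>N. mean N p / N)"
    by (simp add: convergent_def)
  then show ?thesis unfolding moment_def by (rule convergent_LIMSEQ_iff [THEN iffD1])
qed

text \<open>The second cumulant is the covariance. It is of order N only, hence negligible after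
  division by N^2, and the limit of the product moment factorises.\<close>

lemma mean2_tendsto: "(\<lambda>N. mean2 N p q / (real N)\<^sup>2) \<longlonglongrightarrow> moment p * moment q"
proof -
  let ?r = "\<lambda>i::nat. if i = 0 then p else q"
  have cum: "jacobi_cumulant a b \<alpha> 2 ?r N = mean2 N p q - mean N p * mean N q" for N
    by (simp add: jacobi_cumulant_def joint_cumulant_2 mean_def mean2_def power_sum_def)
  obtain c where "(\<lambda>N. jacobi_cumulant a b \<alpha> 2 ?r N / N) \<longlonglongrightarrow> c"
    using cumulant_asymp [of 2 ?r] by auto
  then have "(\<lambda>N. jacobi_cumulant a b \<alpha> 2 ?r N / N * (1 / real N) + mean N p / N * (mean N q / N))
      \<longlonglongrightarrow> c * 0 + moment p * moment q"
    by (intro tendsto_intros mean_tendsto lim_1_over_n)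
  moreover have "jacobi_cumulant a b \<alpha> 2 ?r N / N * (1 / real N) + mean N p / N * (mean N q / N)
      = mean2 N p q / (real N)\<^sup>2" for N
    unfolding cum by (simp add: power2_eq_square diff_divide_distrib)
  ultimately show ?thesis by simp
qed

lemma moment_0: "moment 0 = 1"
proof -
  have mean_0: "mean N 0 / N = 1" if "0 < N" for N
    using that emeasure_jacobi_ensemble_space [OF a_gt b_gt \<alpha>_gt that]
    by (simp add: mean_def power_sum_def measure_def)
  have "(\<lambda>N. mean N 0 / N) \<longlonglongrightarrow> 1"
    by (intro tendsto_eventually eventually_mono [OF eventually_gt_at_top [of 0]] mean_0)
  with mean_tendsto [of 0] show ?thesis by (rule LIMSEQ_unique)
qed

text \<open>Dividing the loop equation by N sends 1 - \<alpha>/N to 1 and turns (\<alpha>/N)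
  \<open>mean2\<close> into \<alpha> times \<open>mean2\<close> divided by N^2, which has a finite
  limit.\<close>

lemma moment_recursion:
  "real (Suc p) * moment p - real (Suc (Suc p)) * moment (Suc p)
     + a * (moment p - moment (Suc p)) - b * moment (Suc p)
     + \<alpha> * ((\<Sum>i<Suc p. moment i * moment (p - i)) - (\<Sum>i<Suc (Suc p). moment i * moment (Suc p - i))) = 0"
  (is "?L = 0")
proof -
  let ?m = "\<lambda>N p. mean N p / N" and ?m2 = "\<lambda>N p q. mean2 N p q / (real N)\<^sup>2"
  have "(\<lambda>N. (1 - \<alpha> * (1 / real N)) * (real (Suc p) * ?m N p - real (Suc (Suc p)) * ?m N (Suc p))
     + a * (?m N p - ?m N (Suc p)) - b * ?m N (Suc p)
     + \<alpha> * ((\<Sum>i<Suc p. ?m2 N i (p - i)) - (\<Sum>i<Suc (Suc p). ?m2 N i (Suc p - i))))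
    \<longlonglongrightarrow> (1 - \<alpha> * 0) * (real (Suc p) * moment p - real (Suc (Suc p)) * moment (Suc p))
     + a * (moment p - moment (Suc p)) - b * moment (Suc p)
     + \<alpha> * ((\<Sum>i<Suc p. moment i * moment (p - i)) - (\<Sum>i<Suc (Suc p). moment i * moment (Suc p - i)))"
    by (intro tendsto_intros mean_tendsto mean2_tendsto lim_1_over_n)
  moreover have "\<forall>\<^sub>F N in sequentially. (1 - \<alpha> * (1 / real N)) * (real (Suc p) * ?m N p - real (Suc (Suc p)) * ?m N (Suc p))
     + a * (?m N p - ?m N (Suc p)) - b * ?m N (Suc p)
     + \<alpha> * ((\<Sum>i<Suc p. ?m2 N i (p - i)) - (\<Sum>i<Suc (Suc p). ?m2 N i (Suc p - i))) = 0"
    using eventually_gt_at_top [of 0]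
  proof eventually_elim
    case (elim N)
    define S where "S = (\<Sum>i<Suc p. mean2 N i (p - i)) - (\<Sum>i<Suc (Suc p). mean2 N i (Suc p - i))"
    have S: "(\<Sum>i<Suc p. ?m2 N i (p - i)) - (\<Sum>i<Suc (Suc p). ?m2 N i (Suc p - i)) = S / (real N)\<^sup>2"
      unfolding S_def by (simp only: sum_divide_distrib diff_divide_distrib)
    have "((1 - \<alpha> / N) * (real (Suc p) * mean N p - real (Suc (Suc p)) * mean N (Suc p))
     + a * (mean N p - mean N (Suc p)) - b * mean N (Suc p) + (\<alpha> / N) * S) / N = 0"
      using mean_loop_equation [OF elim, of p] unfolding S_def by simp
    then show ?case unfolding S
      using elim
      by (simp add: power2_eq_square add_divide_distrib diff_divide_distrib right_diff_distrib del: of_nat_Suc)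
  qed
  ultimately have "(\<lambda>N. 0) \<longlonglongrightarrow> (1 - \<alpha> * 0) * (real (Suc p) * moment p - real (Suc (Suc p)) * moment (Suc p))
     + a * (moment p - moment (Suc p)) - b * moment (Suc p)
     + \<alpha> * ((\<Sum>i<Suc p. moment i * moment (p - i)) - (\<Sum>i<Suc (Suc p). moment i * moment (Suc p - i)))"
    by (rule Lim_transform_eventually)
  from LIMSEQ_unique [OF this tendsto_const] show ?thesis by simp
qed

end

section \<open>Limits of linear statistics\<close>

text \<open>Continuity is demanded on [0,1] only, because kernels such as t/(1 - z t) may have a
  pole elsewhere on the real line; global measurability keeps the linear statistics
  measurable.\<close>

definition test_fun :: "(real \<Rightarrow> complex) \<Rightarrow> bool" where
  "test_fun f \<longleftrightarrow> f \<in> borel_measurable borel \<and> continuous_on {0..1} f"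

lemma test_fun_bounded:
  assumes "test_fun f"
  obtains C where "\<And>t. t \<in> {0..1} \<Longrightarrow> norm (f t) \<le> C"
proof -
  have "compact (f ` {0..1})"
    using assms by (intro compact_continuous_image) (auto simp: test_fun_def)
  then have "bounded (f ` {0..1})" by (rule compact_imp_bounded)
  then obtain C where "\<forall>x\<in>f ` {0..1}. norm x \<le> C" by (auto simp: bounded_iff)
  then show ?thesis by (intro that [of C]) auto
qed

lemma test_fun_const: "test_fun (\<lambda>t. c)"
  by (simp add: test_fun_def)

lemma test_fun_add: "test_fun f \<Longrightarrow> test_fun g \<Longrightarrow> test_fun (\<lambda>t. f t + g t)"
  by (auto simp: test_fun_def intro!: continuous_intros)

lemma test_fun_diff: "test_fun f \<Longrightarrow> test_fun g \<Longrightarrow> test_fun (\<lambda>t. f t - g t)"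
  by (auto simp: test_fun_def intro!: continuous_intros)

lemma test_fun_cmult: "test_fun f \<Longrightarrow> test_fun (\<lambda>t. c * f t)"
  by (auto simp: test_fun_def intro!: continuous_intros)

lemma test_fun_monomial: "test_fun (\<lambda>t. complex_of_real (t ^ p))"
  by (auto simp: test_fun_def intro!: continuous_intros)

lemma test_fun_sum: "(\<And>i. i \<in> A \<Longrightarrow> test_fun (f i)) \<Longrightarrow> test_fun (\<lambda>t. \<Sum>i\<in>A. f i t)"
  unfolding test_fun_def by (auto intro: borel_measurable_sum continuous_on_sum)

text \<open>Connects the polynomials supplied by the Stone-Weierstrass theorem with the monomials,
  whose averages are known to converge.\<close>

lemma complex_polynomial_function_eq_sum:
  fixes g :: "real \<Rightarrow> complex"
  assumes "polynomial_function g"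
  obtains c n c' n' where
    "g = (\<lambda>t. (\<Sum>i\<le>n. complex_of_real (c i) * of_real (t ^ i)) + \<i> * (\<Sum>i\<le>n'. complex_of_real (c' i) * of_real (t ^ i)))"
proof -
  have "real_polynomial_function (Re \<circ> g)" "real_polynomial_function (Im \<circ> g)"
    using assms bounded_linear_Re bounded_linear_Im unfolding polynomial_function_def by auto
  then obtain c n c' n' where c: "Re \<circ> g = (\<lambda>t. \<Sum>i\<le>n. c i * t ^ i)" "Im \<circ> g = (\<lambda>t. \<Sum>i\<le>n'. c' i * t ^ i)"
    unfolding real_polynomial_function_iff_sum by blast
  have "g t = complex_of_real ((Re \<circ> g) t) + \<i> * complex_of_real ((Im \<circ> g) t)" for t
    by (simp add: complex_eq [symmetric])
  then have "g = (\<lambda>t. (\<Sum>i\<le>n. complex_of_real (c i) * of_real (t ^ i)) + \<i> * (\<Sum>i\<le>n'. complex_of_real (c' i) * of_real (t ^ i)))"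
    unfolding c by (simp add: fun_eq_iff)
  then show ?thesis by (rule that)
qed

section \<open>The limiting functional on continuous functions\<close>

context jacobi_large_N
begin

definition avg :: "nat \<Rightarrow> (real \<Rightarrow> complex) \<Rightarrow> complex" where
  "avg N f = (\<integral>y. (\<Sum>j<N. f (y j)) \<partial>\<E> N) / of_nat N"

text \<open>Takes the place of integration against the limiting eigenvalue distribution. On
  \<open>test_fun\<close> it is linear and bounded by the supremum norm on [0,1].\<close>

definition Lam :: "(real \<Rightarrow> complex) \<Rightarrow> complex" where
  "Lam f = lim (\<lambda>N. avg N f)"

lemma borel_measurable_linear_statistic:
  fixes f :: "real \<Rightarrow> complex"
  assumes "f \<in> borel_measurable borel"
  shows "(\<lambda>y. \<Sum>j<N. f (y j)) \<in> borel_measurable (lborel_PiM N)"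
  using assms by (intro borel_measurable_sum measurable_compose [OF borel_measurable_PiM_component]) auto

lemma norm_linear_statistic_le:
  fixes f :: "real \<Rightarrow> 'b::real_normed_vector"
  assumes "\<And>t. t \<in> {0..1} \<Longrightarrow> norm (f t) \<le> C" "\<forall>l<N. 0 < y l \<and> y l < 1"
  shows "norm (\<Sum>j<N. f (y j)) \<le> real N * C"
proof -
  have "norm (\<Sum>j<N. f (y j)) \<le> (\<Sum>j<N. C)"
    using assms by (intro sum_norm_le) (auto simp: less_imp_le)
  then show ?thesis by simp
qed

lemma integrable_linear_statistic:
  assumes "0 < N" "test_fun f"
  shows "integrable (\<E> N) (\<lambda>y. \<Sum>j<N. f (y j))"
proof -
  obtain C where C: "\<And>t. t \<in> {0..1} \<Longrightarrow> norm (f t) \<le> C" by (rule test_fun_bounded [OF assms(2)]) blast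
  show ?thesis
    using assms by (intro integrable_ensemble [where C = "real N * C"] borel_measurable_linear_statistic norm_linear_statistic_le [OF C])
      (auto simp: test_fun_def)
qed

lemma norm_avg_le:
  assumes N: "0 < N" and f: "test_fun f" and C: "\<And>t. t \<in> {0..1} \<Longrightarrow> norm (f t) \<le> C"
  shows "norm (avg N f) \<le> C"
proof -
  have "norm (\<integral>y. (\<Sum>j<N. f (y j)) \<partial>\<E> N) \<le> real N * C"
    using N f by (intro norm_integral_ensemble_le borel_measurable_linear_statistic norm_linear_statistic_le [OF C])
      (auto simp: test_fun_def)
  then show ?thesis using N by (simp add: avg_def norm_divide field_simps)
qed

lemma avg_add:
  assumes "0 < N" "test_fun f" "test_fun g"
  shows "avg N (\<lambda>t. f t + g t) = avg N f + avg N g"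
  unfolding avg_def using assms
  by (simp add: sum.distrib integrable_linear_statistic add_divide_distrib)

lemma avg_cmult: "avg N (\<lambda>t. c * f t) = c * avg N f"
  unfolding avg_def by (simp add: sum_distrib_left [symmetric])

lemma avg_monomial: "avg N (\<lambda>t. complex_of_real (t ^ p)) = of_real (mean N p / N)"
proof -
  have "(\<integral>y. (\<Sum>j<N. complex_of_real (y j ^ p)) \<partial>\<E> N) = (\<integral>y. complex_of_real (power_sum N p y) \<partial>\<E> N)"
    by (simp add: power_sum_def)
  then show ?thesis by (simp add: avg_def mean_def)
qed

lemma avg_tendsto_add:
  assumes "test_fun f" "test_fun g" "(\<lambda>N. avg N f) \<longlonglongrightarrow> A" "(\<lambda>N. avg N g) \<longlonglongrightarrow> B"
  shows "(\<lambda>N. avg N (\<lambda>t. f t + g t)) \<longlonglongrightarrow> A + B"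
  using assms
  by (intro Lim_transform_eventually [OF tendsto_add [OF assms(3,4)]]
       eventually_mono [OF eventually_gt_at_top [of 0]]) (simp add: avg_add)

lemma avg_tendsto_cmult:
  assumes "(\<lambda>N. avg N f) \<longlonglongrightarrow> A"
  shows "(\<lambda>N. avg N (\<lambda>t. c * f t)) \<longlonglongrightarrow> c * A"
  unfolding avg_cmult using assms by (rule tendsto_mult_left)

lemma avg_tendsto_monomial: "(\<lambda>N. avg N (\<lambda>t. complex_of_real (t ^ p))) \<longlonglongrightarrow> of_real (moment p)"
  unfolding avg_monomial by (intro tendsto_of_real mean_tendsto)

lemma avg_tendsto_sum:
  "(\<lambda>N. avg N (\<lambda>t. \<Sum>i<n. c i * complex_of_real (t ^ i))) \<longlonglongrightarrow> (\<Sum>i<n. c i * of_real (moment i))"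
proof (induction n)
  case 0
  then show ?case by (simp add: avg_def)
next
  case (Suc n)
  then show ?case unfolding sum.lessThan_Suc
    by (intro avg_tendsto_add test_fun_sum test_fun_cmult test_fun_monomial avg_tendsto_cmult avg_tendsto_monomial)
qed

text \<open>\<open>avg N\<close> is a contraction for the supremum norm on [0,1], uniformly in N >
  0. Hence the Cauchy property passes from a polynomial g to f: two approximation errors and one
  fluctuation, e/4 each.\<close>

lemma avg_tendsto:
  assumes f: "test_fun f"
  shows "(\<lambda>N. avg N f) \<longlonglongrightarrow> Lam f"
proof -
  have "Cauchy (\<lambda>N. avg N f)"
  proof (rule metric_CauchyI)
    fix e :: real assume e: "e > 0"
    obtain g where g: "polynomial_function g" "\<And>t. t \<in> {0..1} \<Longrightarrow> norm (f t - g t) < e / 4"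
      using Stone_Weierstrass_polynomial_function [of "{0..1}" f "e / 4"] f e by (auto simp: test_fun_def)
    obtain c n c' n' where geq:
      "g = (\<lambda>t. (\<Sum>i\<le>n. complex_of_real (c i) * of_real (t ^ i)) + \<i> * (\<Sum>i\<le>n'. complex_of_real (c' i) * of_real (t ^ i)))"
      by (rule complex_polynomial_function_eq_sum [OF g(1)]) blast
    have tg: "test_fun g"
      unfolding geq by (intro test_fun_add test_fun_sum test_fun_cmult test_fun_monomial)
    have t: "test_fun (\<lambda>t. \<Sum>i\<in>A. complex_of_real (c i) * complex_of_real (t ^ i))" for c :: "nat \<Rightarrow> real" and A
      by (intro test_fun_sum test_fun_cmult test_fun_monomial)
    have "convergent (\<lambda>N. avg N g)"
      unfolding geq lessThan_Suc_atMost [symmetric]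
      by (rule convergentI [OF avg_tendsto_add [OF t test_fun_cmult [OF t] avg_tendsto_sum
            avg_tendsto_cmult [OF avg_tendsto_sum]]])
    then have "Cauchy (\<lambda>N. avg N g)" by (rule convergent_Cauchy)
    then obtain M where M: "\<And>m n. m \<ge> M \<Longrightarrow> n \<ge> M \<Longrightarrow> dist (avg m g) (avg n g) < e / 4"
      using metric_CauchyD [of _ "e / 4"] e by force
    have fg: "norm (avg N f - avg N g) \<le> e / 4" if "0 < N" for N
    proof -
      have tfg: "test_fun (\<lambda>t. f t - g t)" by (intro test_fun_diff f tg)
      have "avg N f = avg N (\<lambda>t. (f t - g t) + g t)" by simp
      also have "\<dots> = avg N (\<lambda>t. f t - g t) + avg N g" by (intro avg_add that tfg tg)
      finally have "avg N f - avg N g = avg N (\<lambda>t. f t - g t)" by simp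
      also have "norm \<dots> \<le> e / 4" using g(2) by (intro norm_avg_le that tfg) (auto simp: less_imp_le)
      finally show ?thesis .
    qed
    have "dist (avg m f) (avg n f) < e" if "m \<ge> Suc M" "n \<ge> Suc M" for m n
    proof -
      have "dist (avg m g) (avg n g) < e / 4" using M that by auto
      moreover have "dist (avg m f) (avg m g) \<le> e / 4" "dist (avg n g) (avg n f) \<le> e / 4"
        using fg [of m] fg [of n] that by (auto simp: dist_norm norm_minus_commute)
      ultimately show ?thesis
        using dist_triangle [of "avg m f" "avg n f" "avg m g"] dist_triangle [of "avg m g" "avg n f" "avg n g"] e
        by linarith
    qed
    then show "\<exists>M. \<forall>m\<ge>M. \<forall>n\<ge>M. dist (avg m f) (avg n f) < e" by blast
  qed
  then have "convergent (\<lambda>N. avg N f)" by (rule Cauchy_convergent)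
  then show ?thesis unfolding Lam_def by (rule convergent_LIMSEQ_iff [THEN iffD1])
qed

lemma Lam_eqI: "test_fun f \<Longrightarrow> (\<lambda>N. avg N f) \<longlonglongrightarrow> A \<Longrightarrow> Lam f = A"
  using LIMSEQ_unique [OF avg_tendsto] .

lemma Lam_add: "test_fun f \<Longrightarrow> test_fun g \<Longrightarrow> Lam (\<lambda>t. f t + g t) = Lam f + Lam g"
  by (intro Lam_eqI avg_tendsto_add avg_tendsto test_fun_add)

lemma Lam_cmult: "test_fun f \<Longrightarrow> Lam (\<lambda>t. c * f t) = c * Lam f"
  by (intro Lam_eqI avg_tendsto_cmult avg_tendsto test_fun_cmult)

lemma Lam_diff:
  assumes "test_fun f" "test_fun g"
  shows "Lam (\<lambda>t. f t - g t) = Lam f - Lam g"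
  using Lam_add [OF assms(1) test_fun_cmult [OF assms(2), of "-1"]] Lam_cmult [OF assms(2), of "-1"]
  by simp

lemma Lam_sum: "Lam (\<lambda>t. \<Sum>i<n. c i * complex_of_real (t ^ i)) = (\<Sum>i<n. c i * of_real (moment i))"
  by (intro Lam_eqI avg_tendsto_sum test_fun_sum test_fun_cmult test_fun_monomial)

lemma Lam_const: "Lam (\<lambda>t. 1) = 1"
  using Lam_sum [of "\<lambda>_. 1" 1] by (simp add: moment_0)

lemma norm_Lam_le:
  assumes "test_fun f" "\<And>t. t \<in> {0..1} \<Longrightarrow> norm (f t) \<le> C"
  shows "norm (Lam f) \<le> C"
  using avg_tendsto [OF assms(1)]
  by (rule LIMSEQ_le_const2 [OF tendsto_norm]) (auto intro!: exI [of _ 1] norm_avg_le assms)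

lemma Lam_cong:
  assumes "test_fun f" "test_fun g" "\<And>t. t \<in> {0..1} \<Longrightarrow> f t = g t"
  shows "Lam f = Lam g"
proof -
  have "norm (Lam (\<lambda>t. f t - g t)) \<le> 0"
    using assms by (intro norm_Lam_le test_fun_diff) auto
  then show ?thesis by (simp add: Lam_diff assms)
qed

end

section \<open>Resolvent and Riccati equation\<close>

text \<open>Contains 1/x for every x off [0,1], and also 0, the image of x = infinity, where power
  series are expanded.\<close>

definition cut_plane :: "complex set" where
  "cut_plane = - (complex_of_real ` {1..})"

lemma open_cut_plane: "open cut_plane"
proof -
  have "closed (complex_of_real ` {1..})"
    by (intro closed_injective_linear_image) (auto simp: inj_on_def linear_of_real)
  then show ?thesis unfolding cut_plane_def by (rule open_Compl)
qed

lemma cut_plane_denom: "z \<in> cut_plane \<Longrightarrow> t \<in> {0..1} \<Longrightarrow> 1 - z * complex_of_real t \<noteq> 0"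
proof
  assume z: "z \<in> cut_plane" and t: "t \<in> {0..1}" and eq: "1 - z * complex_of_real t = 0"
  then have "t > 0" by (cases "t = 0") auto
  with eq have "z = complex_of_real (1 / t)" by (simp add: field_simps)
  moreover have "1 / t \<in> {1..}" using t \<open>t > 0\<close> by simp
  ultimately have "z \<in> complex_of_real ` {1..}" by (rule image_eqI)
  then show False using z by (simp add: cut_plane_def)
qed

lemma cut_plane_scale:
  assumes "z \<in> cut_plane" "t \<in> {0..1}"
  shows "complex_of_real t * z \<in> cut_plane"
proof (rule ccontr)
  assume "complex_of_real t * z \<notin> cut_plane"
  then obtain r where r: "r \<ge> 1" "complex_of_real t * z = of_real r" by (auto simp: cut_plane_def)
  then have "t \<noteq> 0" by auto
  then have "z = complex_of_real (r / t)" using r by (simp add: field_simps)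
  moreover have "r / t \<in> {1..}" using assms r \<open>t \<noteq> 0\<close> by (simp add: field_simps)
  ultimately have "z \<in> complex_of_real ` {1..}" by (rule image_eqI)
  then show False using assms by (simp add: cut_plane_def)
qed

lemma zero_in_cut_plane: "0 \<in> cut_plane"
  by (auto simp: cut_plane_def)

lemma starlike_cut_plane: "starlike cut_plane"
  unfolding starlike_def
proof (intro bexI ballI subsetI)
  fix z w assume "z \<in> cut_plane" "w \<in> closed_segment 0 z"
  then show "w \<in> cut_plane" using cut_plane_scale [of z] by (auto simp: closed_segment_def scaleR_conv_of_real)
qed (rule zero_in_cut_plane)

lemma ball_subset_cut_plane: "ball 0 1 \<subseteq> cut_plane"
  by (auto simp: cut_plane_def)

text \<open>Used with (k, m) = (1, 1) for \<open>resolvK\<close> and (2, 2) for its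
  derivative.\<close>

lemma test_fun_cauchy_kernel:
  assumes "z \<in> cut_plane"
  shows "test_fun (\<lambda>t. complex_of_real (t ^ k) / (1 - z * complex_of_real t) ^ m)"
  unfolding test_fun_def using cut_plane_denom [OF assms]
  by (intro conjI, measurable) (intro continuous_intros, auto)

section \<open>The function K: analyticity and power series\<close>

context jacobi_large_N
begin

text \<open>The geometric series t/(1 - z t) = \<Sum> t^(p+1) z^p makes this the generating series
  of the moments on the unit disc; the kernel itself makes sense on the whole cut plane.\<close>

definition resolvK :: "complex \<Rightarrow> complex" where
  "resolvK z = Lam (\<lambda>t. complex_of_real t / (1 - z * complex_of_real t))"

lemma test_fun_resolvK: "z \<in> cut_plane \<Longrightarrow> test_fun (\<lambda>t. complex_of_real t / (1 - z * complex_of_real t))"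
  using test_fun_cauchy_kernel [of z 1 1] by simp

text \<open>The difference quotient of the kernel misses its derivative by (z - z0) t^3 / ((1 - z t)
  (1 - z0 t)^2), which is small uniformly on [0,1]. Boundedness of \<open>Lam\<close> then allows
  differentiation under the functional.\<close>

lemma resolvK_has_field_derivative:
  assumes z0: "z0 \<in> cut_plane"
  shows "(resolvK has_field_derivative
     Lam (\<lambda>t. complex_of_real (t ^ 2) / (1 - z0 * complex_of_real t) ^ 2)) (at z0)"
proof -
  let ?D = "Lam (\<lambda>t. complex_of_real (t ^ 2) / (1 - z0 * complex_of_real t) ^ 2)"
  have "\<exists>u\<in>{0..1}. \<forall>t\<in>{0..1}. norm (1 - z0 * complex_of_real u) \<le> norm (1 - z0 * complex_of_real t)"
    by (intro continuous_attains_inf continuous_intros) auto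
  then obtain u where u: "u \<in> {0..1}"
    "\<And>t. t \<in> {0..1} \<Longrightarrow> norm (1 - z0 * complex_of_real u) \<le> norm (1 - z0 * complex_of_real t)" by blast
  \<comment> \<open>\<delta> is the least modulus of 1 - z0 t. If z is within \<delta>/2 of z0, then
    1 - z t has modulus at least \<delta>/2, which yields the constant 2/\<delta>^3.\<close>
  define \<delta> where "\<delta> = norm (1 - z0 * complex_of_real u)"
  have \<delta>: "\<delta> > 0" using cut_plane_denom [OF z0 u(1)] by (simp add: \<delta>_def)
  have bound: "norm ((resolvK z - resolvK z0) / (z - z0) - ?D) \<le> norm (z - z0) * (2 / \<delta> ^ 3)"
    if z: "z \<noteq> z0" "norm (z - z0) \<le> \<delta> / 2" "z \<in> cut_plane" for z
  proof -
    let ?k = "\<lambda>z t. complex_of_real t / (1 - z * complex_of_real t)"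
    let ?h = "\<lambda>t. (1 / (z - z0)) * (?k z t - ?k z0 t) - complex_of_real (t ^ 2) / (1 - z0 * complex_of_real t) ^ 2"
    have "Lam ?h = (1 / (z - z0)) * (Lam (?k z) - Lam (?k z0)) - ?D"
      by (subst Lam_diff, intro test_fun_cmult test_fun_diff test_fun_resolvK z0 z(3),
          intro test_fun_cauchy_kernel z0, subst Lam_cmult, intro test_fun_diff test_fun_resolvK z0 z(3),
          subst Lam_diff, intro test_fun_resolvK z(3), intro test_fun_resolvK z0, rule refl)
    then have eq: "(resolvK z - resolvK z0) / (z - z0) - ?D = Lam ?h"
      by (simp add: resolvK_def del: of_real_power)
    have "norm (?h t) \<le> norm (z - z0) * (2 / \<delta> ^ 3)" if t: "t \<in> {0..1}" for t
    proof -
      have nz: "1 - z * complex_of_real t \<noteq> 0" "1 - z0 * complex_of_real t \<noteq> 0"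
        using cut_plane_denom z(3) z0 t by auto
      have d0: "\<delta> \<le> norm (1 - z0 * complex_of_real t)" using u(2) [OF t] by (simp add: \<delta>_def)
      have "norm ((z - z0) * complex_of_real t) \<le> \<delta> / 2 * 1"
        using z(2) t \<delta> unfolding norm_mult by (intro mult_mono) auto
      moreover have "1 - z0 * complex_of_real t = (1 - z * complex_of_real t) + (z - z0) * complex_of_real t"
        by (simp add: algebra_simps)
      then have "norm (1 - z0 * complex_of_real t) \<le> norm (1 - z * complex_of_real t) + norm ((z - z0) * complex_of_real t)"
        by (metis norm_triangle_ineq)
      ultimately have d: "\<delta> / 2 \<le> norm (1 - z * complex_of_real t)" using d0 by linarith
      have "?h t = (z - z0) * complex_of_real t ^ 3 / ((1 - z * complex_of_real t) * (1 - z0 * complex_of_real t) ^ 2)"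
      proof -
        have "?k z t - ?k z0 t = (z - z0) * (complex_of_real t)\<^sup>2 / ((1 - z * complex_of_real t) * (1 - z0 * complex_of_real t))"
          using nz by (simp add: divide_simps) (simp add: power2_eq_square algebra_simps)
        then have "?h t = (complex_of_real t)\<^sup>2 / ((1 - z * complex_of_real t) * (1 - z0 * complex_of_real t)) - (complex_of_real t)\<^sup>2 / (1 - z0 * complex_of_real t) ^ 2"
          using z(1) by simp
        also have "\<dots> = (z - z0) * complex_of_real t ^ 3 / ((1 - z * complex_of_real t) * (1 - z0 * complex_of_real t) ^ 2)"
          using nz by (simp add: divide_simps power2_eq_square power3_eq_cube) (simp add: algebra_simps)
        finally show ?thesis .
      qed
      then have "norm (?h t) = norm (z - z0) * t ^ 3 / (norm (1 - z * complex_of_real t) * norm (1 - z0 * complex_of_real t) ^ 2)"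
        using t by (simp add: norm_mult norm_divide norm_power)
      also have "\<dots> \<le> norm (z - z0) * 1 / ((\<delta> / 2) * \<delta> ^ 2)"
        using t d d0 \<delta> by (intro frac_le mult_mono power_mono mult_left_mono power_le_one mult_pos_pos) auto
      also have "\<dots> = norm (z - z0) * (2 / \<delta> ^ 3)" by (simp add: power2_eq_square power3_eq_cube)
      finally show ?thesis .
    qed
    then show ?thesis unfolding eq
      by (intro norm_Lam_le test_fun_diff test_fun_cmult test_fun_resolvK test_fun_cauchy_kernel z0 z(3))
  qed
  have "((\<lambda>z. (resolvK z - resolvK z0) / (z - z0) - ?D) \<longlongrightarrow> 0) (at z0)"
  proof (rule Lim_null_comparison)
    have "((\<lambda>z. norm (z - z0) * (2 / \<delta> ^ 3)) \<longlongrightarrow> norm (z0 - z0) * (2 / \<delta> ^ 3)) (at z0)"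
      by (intro tendsto_intros)
    then show "((\<lambda>z. norm (z - z0) * (2 / \<delta> ^ 3)) \<longlongrightarrow> 0) (at z0)" by simp
    have "\<forall>\<^sub>F z in at z0. z \<in> cut_plane - {z0} \<inter> UNIV"
      using eventually_at_in_open [OF open_cut_plane z0] by simp
    moreover have "\<forall>\<^sub>F z in at z0. dist z z0 < \<delta> / 2"
      unfolding eventually_at using \<delta> by (intro exI [of _ "\<delta> / 2"]) auto
    ultimately show "\<forall>\<^sub>F z in at z0. norm ((resolvK z - resolvK z0) / (z - z0) - ?D) \<le> norm (z - z0) * (2 / \<delta> ^ 3)"
      by eventually_elim (intro bound, auto simp: dist_norm)
  qed
  then have "((\<lambda>z. (resolvK z - resolvK z0) / (z - z0)) \<longlongrightarrow> ?D) (at z0)"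
    by (rule LIM_zero_cancel)
  then show ?thesis by (simp add: has_field_derivative_iff)
qed

lemma holomorphic_resolvK: "resolvK holomorphic_on cut_plane"
  using resolvK_has_field_derivative has_field_derivative_at_within
  unfolding holomorphic_on_def field_differentiable_def by blast

text \<open>Subtracting n terms of the geometric series from the kernel leaves t (z t)^n / (1 - z
  t), which is at most |z|^n / (1 - |z|) on [0,1].\<close>

lemma resolvK_sums:
  assumes z: "norm z < 1"
  shows "(\<lambda>n. of_real (moment (Suc n)) * z ^ n) sums resolvK z"
proof -
  have zc: "z \<in> cut_plane" using z ball_subset_cut_plane by auto
  have bound: "norm (resolvK z - (\<Sum>i<n. of_real (moment (Suc i)) * z ^ i)) \<le> norm z ^ n * (1 / (1 - norm z))" for n
  proof -
    let ?k = "\<lambda>t. complex_of_real t / (1 - z * complex_of_real t)"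
    \<comment> \<open>The index is shifted by one: t^i carries z^(i-1) and the constant term is 0,
      which puts the partial sum in the form required by \<open>Lam_sum\<close>.\<close>
    let ?c = "\<lambda>i. if i = 0 then 0 else z ^ (i - 1)"
    let ?p = "\<lambda>t. \<Sum>i<Suc n. ?c i * complex_of_real (t ^ i)"
    have p: "?p t = (\<Sum>i<n. z ^ i * complex_of_real (t ^ Suc i))" for t
      by (subst sum.lessThan_Suc_shift) simp
    have "Lam ?p = (\<Sum>i<Suc n. ?c i * of_real (moment i))" by (rule Lam_sum)
    also have "\<dots> = (\<Sum>i<n. of_real (moment (Suc i)) * z ^ i)"
      by (subst sum.lessThan_Suc_shift) (simp add: mult.commute)
    finally have "resolvK z - (\<Sum>i<n. of_real (moment (Suc i)) * z ^ i) = Lam (\<lambda>t. ?k t - ?p t)"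
      using Lam_diff [OF test_fun_resolvK [OF zc], of ?p]
      by (simp add: resolvK_def test_fun_sum test_fun_cmult test_fun_monomial del: sum.lessThan_Suc of_real_power)
    also have "norm \<dots> \<le> norm z ^ n * (1 / (1 - norm z))"
    proof (rule norm_Lam_le)
      show "test_fun (\<lambda>t. ?k t - ?p t)"
        by (intro test_fun_diff test_fun_resolvK zc test_fun_sum test_fun_cmult test_fun_monomial)
      fix t :: real assume t: "t \<in> {0..1}"
      have nz: "1 - z * complex_of_real t \<noteq> 0" by (rule cut_plane_denom [OF zc t])
      have "?p t = complex_of_real t * (\<Sum>i<n. (z * complex_of_real t) ^ i)"
        unfolding p by (simp add: sum_distrib_left power_mult_distrib algebra_simps)
      also have "(\<Sum>i<n. (z * complex_of_real t) ^ i) = (1 - (z * complex_of_real t) ^ n) / (1 - z * complex_of_real t)"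
        using nz by (subst sum_gp_strict) auto
      finally have "?k t - ?p t = complex_of_real t * (z * complex_of_real t) ^ n / (1 - z * complex_of_real t)"
        by (simp add: diff_divide_distrib [symmetric] algebra_simps)
      then have "norm (?k t - ?p t) = norm z ^ n * t ^ Suc n / norm (1 - z * complex_of_real t)"
        using t by (simp add: norm_mult norm_divide norm_power power_mult_distrib)
      also have "\<dots> \<le> norm z ^ n * 1 / (1 - norm z)"
      proof (intro frac_le mult_left_mono power_le_one)
        have "norm (z * complex_of_real t) \<le> norm z * 1"
          using t unfolding norm_mult by (intro mult_left_mono) auto
        then show "1 - norm z \<le> norm (1 - z * complex_of_real t)"
          using norm_triangle_ineq2 [of 1 "z * complex_of_real t"] by simp
      qed (use t z in auto)
      finally show "norm (?k t - ?p t) \<le> norm z ^ n * (1 / (1 - norm z))" by simp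
    qed
    finally show ?thesis .
  qed
  have "(\<lambda>n. resolvK z - (\<Sum>i<n. of_real (moment (Suc i)) * z ^ i)) \<longlonglongrightarrow> 0"
  proof (rule Lim_null_comparison)
    have "(\<lambda>n. norm z ^ n * (1 / (1 - norm z))) \<longlonglongrightarrow> 0 * (1 / (1 - norm z))"
      using z by (intro tendsto_mult LIMSEQ_realpow_zero) auto
    then show "(\<lambda>n. norm z ^ n * (1 / (1 - norm z))) \<longlonglongrightarrow> 0" by simp
  qed (use bound in auto)
  then have "(\<lambda>n. resolvK z - (resolvK z - (\<Sum>i<n. of_real (moment (Suc i)) * z ^ i))) \<longlonglongrightarrow> resolvK z - 0"
    by (intro tendsto_diff tendsto_const)
  then show ?thesis by (simp add: sums_def)
qed

end

text \<open>Comparing coefficients gives a two-term recursion whose leading factor (n + 1) (c + n)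
  never vanishes, so the value at 0 determines the whole series.\<close>

lemma fps_hypergeometric_ODE_unique:
  fixes f :: "complex fps" and A B c :: complex
  assumes ode: "fps_X * (1 - fps_X) * fps_deriv (fps_deriv f)
      + (fps_const c - fps_const (A + B + 1) * fps_X) * fps_deriv f - fps_const (A * B) * f = 0"
    and f0: "fps_nth f 0 = 1" and c: "\<And>n. c + of_nat n \<noteq> 0"
  shows "f = fps_hypergeo [A, B] [c] 1"
proof -
  have rec: "(of_nat n + 1) * (c + of_nat n) * fps_nth f (Suc n) = (A + of_nat n) * (B + of_nat n) * fps_nth f n" for n
  proof -
    have "fps_X * fps_deriv (fps_deriv f) - fps_X * (fps_X * fps_deriv (fps_deriv f)) + fps_const c * fps_deriv f
       - fps_const (A + B + 1) * (fps_X * fps_deriv f) - fps_const (A * B) * f = 0"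
      using ode by (simp add: algebra_simps)
    then have "fps_nth (fps_X * fps_deriv (fps_deriv f) - fps_X * (fps_X * fps_deriv (fps_deriv f)) + fps_const c * fps_deriv f
       - fps_const (A + B + 1) * (fps_X * fps_deriv f) - fps_const (A * B) * f) n = 0" by simp
    \<comment> \<open>Multiplication by \<open>fps_X\<close> shifts indices down by up to two, so n
      = 0 and n = 1 are separate cases.\<close>
    then show ?thesis
      by (cases n; cases "n - 1") (simp_all add: algebra_simps)
  qed
  have pc: "pochhammer c n \<noteq> 0" for n using c by (auto simp: pochhammer_eq_0_iff add_eq_0_iff2)
  have "fps_nth f n = pochhammer A n * pochhammer B n / (pochhammer c n * fact n)" for n
  proof (induction n)
    case (Suc n)
    have "of_nat n + 1 \<noteq> (0::complex)" by (metis of_nat_Suc of_nat_neq_0 add.commute)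
    then have "fps_nth f (Suc n) = (A + of_nat n) * (B + of_nat n) * fps_nth f n / ((of_nat n + 1) * (c + of_nat n))"
      using rec [of n] c [of n] by (subst nonzero_eq_divide_eq) (auto simp: mult_ac)
    then show ?case unfolding Suc
      by (simp add: pochhammer_Suc mult_ac add_ac)
  qed (simp add: f0)
  then show ?thesis by (simp add: fps_eq_iff)
qed

lemma connected_cut_plane: "connected cut_plane"
  by (rule starlike_imp_connected [OF starlike_cut_plane])

lemma one_notin_cut_plane: "1 \<notin> cut_plane"
  by (auto simp: cut_plane_def intro: image_eqI [of _ _ 1])

text \<open>Off the unit disc \<open>gauss_2F1\<close> is a choice among continuations. F witnesses
  that one exists, and the identity theorem on the connected cut plane shows that any choice agrees
  with F.\<close>

lemma gauss_2F1_eqI: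
  assumes F: "F holomorphic_on cut_plane"
    and eq: "\<And>w. w \<in> ball 0 1 \<Longrightarrow> F w = eval_fps (fps_hypergeo [A, B] [c] 1) w"
    and z: "z \<in> cut_plane"
  shows "gauss_2F1 A B c z = F z"
proof (cases "norm z < 1")
  case True
  then show ?thesis using eq [of z] by (simp add: gauss_2F1_def)
next
  case False
  define G where "G = (SOME F. F holomorphic_on cut_plane \<and>
              (\<forall>w\<in>ball 0 1. F w = eval_fps (fps_hypergeo [A, B] [c] 1) w))"
  have G: "G holomorphic_on cut_plane \<and> (\<forall>w\<in>ball 0 1. G w = eval_fps (fps_hypergeo [A, B] [c] 1) w)"
    unfolding G_def by (rule someI [of _ F]) (use F eq in auto)
  have "G z = F z"
    by (rule analytic_continuation_open [of "ball 0 1" cut_plane])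
       (use G F eq z open_cut_plane connected_cut_plane ball_subset_cut_plane in auto)
  then show ?thesis using False by (simp add: gauss_2F1_def G_def cut_plane_def)
qed

section \<open>The Riccati equation for K and its linearisation\<close>

context jacobi_large_N
begin

abbreviation A :: complex where "A \<equiv> complex_of_real a"
abbreviation B :: complex where "B \<equiv> complex_of_real b"
abbreviation \<alpha>c :: complex where "\<alpha>c \<equiv> complex_of_real \<alpha>"

definition resolvK_fps :: "complex fps" where
  "resolvK_fps = Abs_fps (\<lambda>n. of_real (moment (Suc n)))"

lemma resolvK_has_fps_expansion: "resolvK has_fps_expansion resolvK_fps"
proof -
  have "fps_conv_radius resolvK_fps \<ge> 1"
    unfolding fps_conv_radius_def
  proof (rule conv_radius_geI_ex')
    fix r :: real assume r: "0 < r" "ereal r < 1"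
    then show "summable (\<lambda>n. fps_nth resolvK_fps n * of_real r ^ n)"
      using resolvK_sums [of "of_real r"] by (simp add: resolvK_fps_def sums_iff)
  qed
  then have "0 < fps_conv_radius resolvK_fps" by (rule less_le_trans [rotated]) simp
  moreover have "\<forall>\<^sub>F z in nhds 0. z \<in> ball (0::complex) 1"
    by (intro eventually_nhds_in_open) auto
  then have "\<forall>\<^sub>F z in nhds 0. eval_fps resolvK_fps z = resolvK z"
  proof eventually_elim
    case (elim z)
    then show ?case using resolvK_sums [of z] by (simp add: eval_fps_def resolvK_fps_def sums_iff)
  qed
  ultimately show ?thesis by (simp add: has_fps_expansion_def)
qed

text \<open>The moment recursion in generating-function form. Passing from all moments (G) to those
  of index at least 1 (K) leaves an overall factor \<open>fps_X\<close>, which is cancelled because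
  power series over the complex numbers have no zero divisors.\<close>

lemma resolvK_fps_Riccati:
  defines "K \<equiv> resolvK_fps"
  shows "(fps_X - 1) * fps_X * (fps_deriv K + fps_const \<alpha>c * K\<^sup>2)
    + ((fps_X - 1) * fps_const (2 + 2 * \<alpha>c + A) - fps_const B) * K + fps_const (\<alpha>c + A + 1) = 0"
    (is "?R = 0")
proof -
  define G where "G = Abs_fps (\<lambda>n. complex_of_real (moment n))"
  have G: "G = 1 + fps_X * K"
    by (rule fps_ext) (simp add: G_def K_def resolvK_fps_def moment_0 split: nat.split)
  \<comment> \<open>Collects the terms that enter the recursion at both p and p + 1, which then
    reads H_p - H_(p+1) - b m_(p+1) = 0.\<close>
  define H where "H = G + fps_X * fps_deriv G + fps_const \<alpha>c * (G * G) + fps_const A * G"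
  have H: "fps_nth H n = of_real (real (Suc n) * moment n + \<alpha> * (\<Sum>i<Suc n. moment i * moment (n - i)) + a * moment n)" for n
  proof -
    have "fps_nth (G * G) n = of_real (\<Sum>i<Suc n. moment i * moment (n - i))"
      by (simp add: G_def fps_mult_nth atLeast0AtMost lessThan_Suc_atMost)
    moreover have "fps_nth (fps_X * fps_deriv G) n = of_real (real n * moment n)"
      by (cases n) (simp_all add: G_def)
    ultimately show ?thesis
      unfolding H_def by (simp add: algebra_simps) (simp add: G_def algebra_simps)
  qed
  have const: "fps_const (2 + 2 * \<alpha>c + A) = 2 + 2 * fps_const \<alpha>c + fps_const A"
      "fps_const (\<alpha>c + A + 1) = fps_const \<alpha>c + fps_const A + 1"
      "fps_const (1 + A + B + \<alpha>c) = 1 + fps_const A + fps_const B + fps_const \<alpha>c"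
    by (simp_all add: numeral_fps_const fps_const_1_eq_1 [symmetric] del: fps_const_1_eq_1)
  \<comment> \<open>The recursion says nothing about the coefficient of index 0; the added constant
    1 + a + b + \<alpha> cancels -H_0 - b there.\<close>
  have "fps_X * ?R = (fps_X - 1) * H - fps_const B * G + fps_const (1 + A + B + \<alpha>c)"
    unfolding H_def G const
    by (simp add: algebra_simps power2_eq_square del: fps_const_add fps_const_mult)
  also have "\<dots> = 0"
  proof (rule fps_ext)
    fix n
    show "fps_nth ((fps_X - 1) * H - fps_const B * G + fps_const (1 + A + B + \<alpha>c)) n = fps_nth 0 n"
    proof (cases n)
      case 0
      then show ?thesis by (simp add: H left_diff_distrib moment_0) (simp add: G_def moment_0)
    next
      case (Suc p)
      have "fps_nth ((fps_X - 1) * H - fps_const B * G + fps_const (1 + A + B + \<alpha>c)) n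
          = fps_nth H p - fps_nth H (Suc p) - B * of_real (moment (Suc p))"
        by (simp add: Suc left_diff_distrib G_def)
      also have "\<dots> = of_real (real (Suc p) * moment p - real (Suc (Suc p)) * moment (Suc p)
         + a * (moment p - moment (Suc p)) - b * moment (Suc p)
         + \<alpha> * ((\<Sum>i<Suc p. moment i * moment (p - i)) - (\<Sum>i<Suc (Suc p). moment i * moment (Suc p - i))))"
        unfolding H by (simp add: algebra_simps del: of_nat_Suc sum.lessThan_Suc)
      also have "\<dots> = 0" unfolding moment_recursion by simp
      finally show ?thesis by simp
    qed
  qed
  finally show ?thesis by simp
qed

text \<open>The Riccati equation of \<open>W\<close> in the variable \<open>z = 1/x\<close>, written for \<open>K\<close>, so that it is regular
  at \<open>z = 0\<close>.\<close>

definition Riccati_expr :: "complex \<Rightarrow> complex" where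
  "Riccati_expr z = (z - 1) * z * (deriv resolvK z + \<alpha>c * (resolvK z)\<^sup>2)
    + ((z - 1) * (2 + 2 * \<alpha>c + A) - B) * resolvK z + (\<alpha>c + A + 1)"

lemma Riccati_expr_eq_0:
  assumes z: "z \<in> cut_plane"
  shows "Riccati_expr z = 0"
proof -
  \<comment> \<open>The series 0 is rewritten as the left side of the formal Riccati equation, which
    the expansion rules can assemble term by term.\<close>
  have "Riccati_expr has_fps_expansion 0"
    unfolding Riccati_expr_def [abs_def] resolvK_fps_Riccati [symmetric]
    by (intro fps_expansion_intros resolvK_has_fps_expansion)
  then have "\<forall>\<^sub>F z in nhds 0. Riccati_expr z = 0" by (simp add: has_fps_expansion_0_iff)
  then obtain S where S: "open S" "0 \<in> S" "\<And>z. z \<in> S \<Longrightarrow> Riccati_expr z = 0"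
    unfolding eventually_nhds by blast
  have holo: "Riccati_expr holomorphic_on cut_plane"
    unfolding Riccati_expr_def [abs_def]
    by (intro holomorphic_intros holomorphic_resolvK open_cut_plane)
  show ?thesis
    by (rule analytic_continuation_open [of "S \<inter> cut_plane" cut_plane _ "\<lambda>_. 0"])
       (use S holo z open_cut_plane connected_cut_plane zero_in_cut_plane in auto)
qed

text \<open>From F' = \<alpha> K F follows F'' = \<alpha> (K' + \<alpha> K^2) F. The Riccati
  equation contains K' and K^2 in this same combination, so the equation for F is linear.\<close>

lemma hypergeometric_primitive:
  obtains F where "F holomorphic_on cut_plane"
    "\<And>z. z \<in> cut_plane \<Longrightarrow> (F has_field_derivative \<alpha>c * resolvK z * F z) (at z)"
    "\<And>z. z \<in> cut_plane \<Longrightarrow> gauss_2F1 \<alpha>c (\<alpha>c + A + 1) (2 * \<alpha>c + A + B + 2) z = F z" "F 0 = 1"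
proof -
  have "\<exists>H. \<forall>z\<in>cut_plane. (H has_field_derivative resolvK z) (at z)"
    using holomorphic_resolvK open_cut_plane
    by (intro holomorphic_starlike_primitive [where k = "{}"] starlike_cut_plane)
       (auto intro: holomorphic_on_imp_continuous_on holomorphic_on_imp_differentiable_at)
  then obtain H where H: "\<And>z. z \<in> cut_plane \<Longrightarrow> (H has_field_derivative resolvK z) (at z)" by blast
  define F where "F z = exp (\<alpha>c * (H z - H 0))" for z
  have F': "(F has_field_derivative \<alpha>c * resolvK z * F z) (at z)" if "z \<in> cut_plane" for z
    unfolding F_def using H [OF that] by (auto intro!: derivative_eq_intros)
  have F0: "F 0 = 1" by (simp add: F_def)
  have holo: "F holomorphic_on cut_plane"
    using F' has_field_derivative_at_within unfolding holomorphic_on_def field_differentiable_def by blast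
  define f where "f = fps_expansion F 0"
  have f: "F has_fps_expansion f"
    unfolding f_def by (rule has_fps_expansion_fps_expansion [OF open_cut_plane zero_in_cut_plane holo])
  have f': "fps_deriv f = fps_const \<alpha>c * resolvK_fps * f"
  proof (rule fps_expansion_unique_complex)
    show "deriv F has_fps_expansion fps_deriv f" using f by (rule has_fps_expansion_deriv)
    have "(\<lambda>z. \<alpha>c * resolvK z * F z) has_fps_expansion fps_const \<alpha>c * resolvK_fps * f"
      by (intro fps_expansion_intros resolvK_has_fps_expansion f)
    moreover have "\<forall>\<^sub>F z in nhds 0. \<alpha>c * resolvK z * F z = deriv F z"
      using eventually_nhds_in_open [OF open_cut_plane zero_in_cut_plane]
      by eventually_elim (simp add: DERIV_imp_deriv [OF F'])
    ultimately show "deriv F has_fps_expansion fps_const \<alpha>c * resolvK_fps * f"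
      by (simp cong: has_fps_expansion_cong)
  qed
  have f'': "fps_deriv (fps_deriv f) = fps_const \<alpha>c * (fps_deriv resolvK_fps + fps_const \<alpha>c * resolvK_fps\<^sup>2) * f"
    unfolding f' by (simp add: f' algebra_simps power2_eq_square)
  let ?b = "\<alpha>c + A + 1" and ?c = "2 * \<alpha>c + A + B + 2"
  have "f = fps_hypergeo [\<alpha>c, ?b] [?c] 1"
  proof (rule fps_hypergeometric_ODE_unique)
    have const: "fps_const ?c = 2 * fps_const \<alpha>c + fps_const A + fps_const B + 2"
        "fps_const (\<alpha>c + ?b + 1) = 2 * fps_const \<alpha>c + fps_const A + 2"
        "fps_const (\<alpha>c * ?b) = fps_const \<alpha>c * (fps_const \<alpha>c + fps_const A + 1)"
        "fps_const (2 + 2 * \<alpha>c + A) = 2 + 2 * fps_const \<alpha>c + fps_const A"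
        "fps_const (\<alpha>c + A + 1) = fps_const \<alpha>c + fps_const A + 1"
      by (simp_all add: numeral_fps_const fps_const_1_eq_1 [symmetric] algebra_simps del: fps_const_1_eq_1)
    \<comment> \<open>The hypergeometric operator applied to f is -\<alpha> f times the Riccati
      expression; this fixes the parameters \<alpha>, \<alpha> + a + 1 and 2 \<alpha> + a + b +
      2.\<close>
    have "fps_X * (1 - fps_X) * fps_deriv (fps_deriv f)
      + (fps_const ?c - fps_const (\<alpha>c + ?b + 1) * fps_X) * fps_deriv f - fps_const (\<alpha>c * ?b) * f
      = - (fps_const \<alpha>c * f) * ((fps_X - 1) * fps_X * (fps_deriv resolvK_fps + fps_const \<alpha>c * resolvK_fps\<^sup>2)
    + ((fps_X - 1) * fps_const (2 + 2 * \<alpha>c + A) - fps_const B) * resolvK_fps + fps_const (\<alpha>c + A + 1))"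
      unfolding f'' unfolding f' const
      by (simp add: algebra_simps power2_eq_square del: fps_const_add fps_const_mult)
    then show "fps_X * (1 - fps_X) * fps_deriv (fps_deriv f)
      + (fps_const ?c - fps_const (\<alpha>c + ?b + 1) * fps_X) * fps_deriv f - fps_const (\<alpha>c * ?b) * f = 0"
      by (simp only: resolvK_fps_Riccati mult_zero_right)
    show "fps_nth f 0 = 1" using has_fps_expansion_imp_0_eq_fps_nth_0 [OF f] F0 by simp
    show "?c + of_nat n \<noteq> 0" for n
    proof -
      have "?c + of_nat n = of_real (2 * \<alpha> + a + b + 2 + real n)" by simp
      \<comment> \<open>Adding \<alpha> > -(1 + a) and \<alpha> > -(1 + b) gives 2 \<alpha> + a + b
        + 2 > 0.\<close>
      moreover have "2 * \<alpha> + a + b + 2 + real n > 0" using \<alpha>_gt by (simp add: min_def split: if_splits)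
      ultimately show ?thesis by (metis of_real_eq_0_iff less_irrefl)
    qed
  qed
  moreover have "eval_fps f w = F w" if "w \<in> ball 0 1" for w
    using eval_fps_expansion' [of F 0 1 w] holomorphic_on_subset [OF holo ball_subset_cut_plane] that
    by (simp add: f_def one_ereal_def)
  ultimately have "F w = eval_fps (fps_hypergeo [\<alpha>c, ?b] [?c] 1) w" if "w \<in> ball 0 1" for w
    using that by simp
  then show ?thesis using that [of F] holo F' F0 gauss_2F1_eqI [OF holo] by blast
qed

end

section \<open>Return to the variable x = 1/z\<close>

lemma inverse_in_cut_plane:
  assumes "x \<notin> complex_of_real ` {0..1}"
  shows "x \<noteq> 0" "1 / x \<in> cut_plane"
proof -
  show x: "x \<noteq> 0" using assms by (auto intro: image_eqI [of _ _ 0])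
  show "1 / x \<in> cut_plane"
  proof (rule ccontr)
    assume "1 / x \<notin> cut_plane"
    then obtain r where r: "r \<ge> 1" "1 / x = of_real r" by (auto simp: cut_plane_def)
    then have "x = complex_of_real (1 / r)" using x by (simp add: field_simps)
    moreover have "1 / r \<in> {0..1}" using r by simp
    ultimately show False using assms by blast
  qed
qed

context jacobi_large_N
begin

lemma test_fun_resolvent:
  assumes "x \<notin> complex_of_real ` {0..1}"
  shows "test_fun (\<lambda>t. 1 / (x - complex_of_real t))"
  unfolding test_fun_def using assms
  by (intro conjI, measurable) (intro continuous_intros, auto)

lemma jacobi_resolvent_eq_avg:
  "jacobi_resolvent a b \<alpha> N x / of_nat N = avg N (\<lambda>t. 1 / (x - complex_of_real t))"
  by (simp add: jacobi_resolvent_def avg_def)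

lemma W10J_eq_Lam: "W10J a b \<alpha> x = Lam (\<lambda>t. 1 / (x - complex_of_real t))"
  by (simp add: W10J_def jacobi_resolvent_eq_avg Lam_def)

text \<open>With z = 1/x the kernel 1/(x - t) equals z + z^2 t/(1 - z t); the first term contributes
  z because \<open>Lam\<close> maps 1 to 1.\<close>

lemma W10J_eq_resolvK:
  assumes x: "x \<notin> complex_of_real ` {0..1}"
  shows "W10J a b \<alpha> x = (1 / x) * (1 + (1 / x) * resolvK (1 / x))"
proof -
  note inv = inverse_in_cut_plane [OF x]
  let ?k = "\<lambda>t. complex_of_real t / (1 - 1 / x * complex_of_real t)"
  have tk: "test_fun ?k" by (rule test_fun_resolvK [OF inv(2)])
  have "W10J a b \<alpha> x = Lam (\<lambda>t. (1 / x) * (1 + (1 / x) * ?k t))"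
    unfolding W10J_eq_Lam
  proof (rule Lam_cong)
    show "test_fun (\<lambda>t. 1 / (x - complex_of_real t))" by (rule test_fun_resolvent [OF x])
    show "test_fun (\<lambda>t. (1 / x) * (1 + (1 / x) * ?k t))"
      by (intro test_fun_cmult test_fun_add test_fun_const tk)
    fix t :: real assume t: "t \<in> {0..1}"
    have nz: "1 - 1 / x * complex_of_real t \<noteq> 0" by (rule cut_plane_denom [OF inv(2) t])
    have "1 + (1 / x) * ?k t = 1 / (1 - 1 / x * complex_of_real t)"
    proof -
      have "1 + (1 / x) * ?k t = ((1 - 1 / x * complex_of_real t) + 1 / x * complex_of_real t) / (1 - 1 / x * complex_of_real t)"
        using nz by (subst add_divide_distrib) simp
      then show ?thesis by simp
    qed
    moreover have "x * (1 - 1 / x * complex_of_real t) = x - complex_of_real t"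
      using inv(1) by (simp add: right_diff_distrib)
    ultimately show "1 / (x - complex_of_real t) = (1 / x) * (1 + (1 / x) * ?k t)"
      by (metis mult_1 times_divide_times_eq)
  qed
  also have "\<dots> = (1 / x) * (Lam (\<lambda>t. 1) + (1 / x) * Lam ?k)"
    by (subst Lam_cmult, intro test_fun_cmult test_fun_add test_fun_const tk,
        subst Lam_add, rule test_fun_const, intro test_fun_cmult tk, subst Lam_cmult, rule tk, rule refl)
  finally show ?thesis by (simp only: Lam_const resolvK_def)
qed

lemma W10J_has_field_derivative:
  assumes x: "x \<notin> complex_of_real ` {0..1}"
  defines "z \<equiv> 1 / x"
  shows "(W10J a b \<alpha> has_field_derivative
     - z\<^sup>2 * (1 + 2 * z * resolvK z + z\<^sup>2 * deriv resolvK z)) (at x)"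
proof -
  note inv = inverse_in_cut_plane [OF x]
  have opn: "open (- (complex_of_real ` {0..1}))"
    by (intro open_Compl compact_imp_closed compact_continuous_image continuous_intros) auto
  have K: "(resolvK has_field_derivative deriv resolvK z) (at z)"
    using holomorphic_derivI [OF holomorphic_resolvK open_cut_plane] inv(2) by (simp add: z_def)
  have inv': "((\<lambda>x. 1 / x) has_field_derivative - z\<^sup>2) (at x)"
    using inv(1) by (auto intro!: derivative_eq_intros simp: z_def power2_eq_square field_simps)
  have K': "((\<lambda>x. resolvK (1 / x)) has_field_derivative deriv resolvK z * (- z\<^sup>2)) (at x)"
    by (rule DERIV_chain2 [OF _ inv']) (use K in \<open>simp add: z_def\<close>)
  have "((\<lambda>x. (1 / x) * (1 + (1 / x) * resolvK (1 / x))) has_field_derivative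
     (- z\<^sup>2) * (1 + z * resolvK z) + z * ((- z\<^sup>2) * resolvK z + z * (deriv resolvK z * (- z\<^sup>2)))) (at x)"
    by (rule DERIV_cong [OF DERIV_mult [OF inv' DERIV_add [OF DERIV_const DERIV_mult [OF inv' K']]]])
       (simp add: z_def [symmetric] algebra_simps)
  then have "(W10J a b \<alpha> has_field_derivative
     (- z\<^sup>2) * (1 + z * resolvK z) + z * ((- z\<^sup>2) * resolvK z + z * (deriv resolvK z * (- z\<^sup>2)))) (at x)"
    by (rule has_field_derivative_transform_within_open [OF _ opn])
       (use x W10J_eq_resolvK in auto)
  then show ?thesis by (rule DERIV_cong) (simp add: algebra_simps power2_eq_square)
qed

text \<open>Multiplied by z - 1, the left side becomes z^3 times \<open>Riccati_expr z\<close>. The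
  factor z - 1 is nonzero because 1 lies on the cut.\<close>

lemma W10J_Riccati:
  assumes x: "x \<notin> complex_of_real ` {0..1}"
  shows "- deriv (W10J a b \<alpha>) x + (A / x - B / (1 - x)) * W10J a b \<alpha> x
             + (1 + A + B + \<alpha>c) / (x * (1 - x)) + \<alpha>c * (W10J a b \<alpha> x)\<^sup>2 = 0"
proof -
  note inv = inverse_in_cut_plane [OF x]
  define z where "z = 1 / x"
  have z: "z \<noteq> 0" "x = 1 / z" using inv(1) by (auto simp: z_def)
  have z1: "z - 1 \<noteq> 0" using one_notin_cut_plane inv(2) by (auto simp: z_def)
  have R: "Riccati_expr z = 0" using Riccati_expr_eq_0 [OF inv(2)] by (simp add: z_def)
  have W: "W10J a b \<alpha> x = z * (1 + z * resolvK z)" using W10J_eq_resolvK [OF x] by (simp add: z_def)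
  have W': "deriv (W10J a b \<alpha>) x = - z\<^sup>2 * (1 + 2 * z * resolvK z + z\<^sup>2 * deriv resolvK z)"
    using W10J_has_field_derivative [OF x] by (intro DERIV_imp_deriv) (simp add: z_def)
  have e1: "A / x = A * z" and e2: "B / (1 - x) = B * z / (z - 1)"
    and e3: "(1 + A + B + \<alpha>c) / (x * (1 - x)) = (1 + A + B + \<alpha>c) * z\<^sup>2 / (z - 1)"
    using z(1) z1 by (simp_all add: z(2) divide_simps power2_eq_square)
  have "(z - 1) * (- deriv (W10J a b \<alpha>) x + (A / x - B / (1 - x)) * W10J a b \<alpha> x
             + (1 + A + B + \<alpha>c) / (x * (1 - x)) + \<alpha>c * (W10J a b \<alpha> x)\<^sup>2) = z ^ 3 * Riccati_expr z"
  proof -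
    have "(z - 1) * (A * z - B * z / (z - 1)) = (z - 1) * A * z - B * z"
         "(z - 1) * ((1 + A + B + \<alpha>c) * z\<^sup>2 / (z - 1)) = (1 + A + B + \<alpha>c) * z\<^sup>2"
      using z1 by (auto simp: right_diff_distrib)
    then have "(z - 1) * (- deriv (W10J a b \<alpha>) x + (A / x - B / (1 - x)) * W10J a b \<alpha> x
             + (1 + A + B + \<alpha>c) / (x * (1 - x)) + \<alpha>c * (W10J a b \<alpha> x)\<^sup>2)
        = (z - 1) * (- deriv (W10J a b \<alpha>) x) + ((z - 1) * A * z - B * z) * W10J a b \<alpha> x
            + (1 + A + B + \<alpha>c) * z\<^sup>2 + (z - 1) * (\<alpha>c * (W10J a b \<alpha> x)\<^sup>2)"
      unfolding e1 e2 e3 by (simp only: distrib_left mult.assoc [symmetric])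
    also have "\<dots> = z ^ 3 * Riccati_expr z"
      unfolding W W' Riccati_expr_def
      by (simp add: algebra_simps power2_eq_square power3_eq_cube)
    finally show ?thesis .
  qed
  then show ?thesis using R z1 by simp
qed

text \<open>A limiting density is tested only against real functions continuous on the whole line,
  whereas k is complex and continuous on [0,1]. Both gaps are closed by passing to real and
  imaginary parts and by clamping the argument.\<close>

lemma Lam_limiting_density:
  assumes \<rho>: "jacobi_limiting_density a b \<alpha> \<rho>" and k: "test_fun k"
  shows "Lam k = (LINT t:{0<..<1}|lborel. complex_of_real (\<rho> t) * k t)"
proof -
  obtain C where C: "\<And>t. t \<in> {0..1} \<Longrightarrow> norm (k t) \<le> C" by (rule test_fun_bounded [OF k]) blast
  have [measurable]: "k \<in> borel_measurable borel" using k by (simp add: test_fun_def)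
  have int\<rho>: "set_integrable lborel {0<..<1} \<rho>" using \<rho> by (simp add: jacobi_limiting_density_def)
  have int: "set_integrable lborel {0<..<1} (\<lambda>t. complex_of_real (\<rho> t) * k t)"
    unfolding set_integrable_def
  proof (rule Bochner_Integration.integrable_bound)
    show "integrable lborel (\<lambda>t. C * (indicator {0<..<1} t *\<^sub>R \<rho> t))"
      using int\<rho> unfolding set_integrable_def by (rule integrable_mult_right)
    have "(\<lambda>t. complex_of_real (indicator {0<..<1} t *\<^sub>R \<rho> t) * k t) \<in> borel_measurable lborel"
      using borel_measurable_integrable [OF int\<rho> [unfolded set_integrable_def]] by measurable
    then show "(\<lambda>t. indicator {0<..<1} t *\<^sub>R (complex_of_real (\<rho> t) * k t)) \<in> borel_measurable lborel"
      by (simp add: scaleR_conv_of_real mult_ac)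
    have "norm (\<rho> t) * norm (k t) \<le> norm (C * \<rho> t)" if "t \<in> {0<..<1}" for t
    proof -
      have c: "norm (k t) \<le> C" using C that by auto
      then have "norm (\<rho> t) * norm (k t) \<le> norm (\<rho> t) * C" by (intro mult_left_mono) auto
      also have "C = \<bar>C\<bar>" using c norm_ge_zero [of "k t"] by linarith
      finally show ?thesis by (simp add: abs_mult mult.commute)
    qed
    then show "AE t in lborel. norm (indicator {0<..<1} t *\<^sub>R (complex_of_real (\<rho> t) * k t))
        \<le> norm (C * (indicator {0<..<1} t *\<^sub>R \<rho> t))"
      by (intro AE_I2) (auto simp: indicator_def norm_mult)
  qed
  \<comment> \<open>h stands for \<open>Re\<close> and \<open>Im\<close> at once; bounded linearity
    lets it commute with both integrals and with the limit.\<close>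
  have part: "h (Lam k) = h (LINT t:{0<..<1}|lborel. complex_of_real (\<rho> t) * k t)"
    if h: "bounded_linear h" for h :: "complex \<Rightarrow> real"
  proof -
    interpret h: bounded_linear h by (rule h)
    \<comment> \<open>Clamping t to [0,1] extends k continuously to the line without changing its
      values at eigenvalues.\<close>
    let ?f = "\<lambda>t. h (k (max 0 (min 1 t)))"
    have "continuous_on UNIV (k \<circ> (\<lambda>t. max 0 (min 1 t)))"
      using k by (intro continuous_on_compose continuous_intros)
        (auto simp: test_fun_def elim!: continuous_on_subset)
    then have "continuous_on UNIV ?f" by (intro h.continuous_on) (simp add: o_def)
    then have lim: "(\<lambda>N. (\<integral>y. (\<Sum>j<N. ?f (y j)) \<partial>\<E> N) / real N)
          \<longlonglongrightarrow> (LINT t:{0<..<1}|lborel. ?f t * \<rho> t)"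
      using \<rho> unfolding jacobi_limiting_density_def by blast
    have "h (avg N k) = (\<integral>y. (\<Sum>j<N. ?f (y j)) \<partial>\<E> N) / real N" if N: "0 < N" for N
    proof -
      have "avg N k = (1 / real N) *\<^sub>R (\<integral>y. (\<Sum>j<N. k (y j)) \<partial>\<E> N)"
        by (simp add: avg_def scaleR_conv_of_real)
      then have "h (avg N k) = h (\<integral>y. (\<Sum>j<N. k (y j)) \<partial>\<E> N) / real N"
        by (simp add: h.scaleR)
      also have "h (\<integral>y. (\<Sum>j<N. k (y j)) \<partial>\<E> N) = (\<integral>y. h (\<Sum>j<N. k (y j)) \<partial>\<E> N)"
        by (rule integral_bounded_linear [OF h integrable_linear_statistic [OF N k], symmetric])
      also have "\<dots> = (\<integral>y. (\<Sum>j<N. ?f (y j)) \<partial>\<E> N)"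
      proof (rule integral_cong_AE)
        show "(\<lambda>y. h (\<Sum>j<N. k (y j))) \<in> borel_measurable (\<E> N)"
          using integrable_bounded_linear [OF h integrable_linear_statistic [OF N k]] by auto
        have m: "?f \<in> borel_measurable borel"
          using \<open>continuous_on UNIV ?f\<close> by (rule borel_measurable_continuous_onI)
        have "(\<lambda>y. \<Sum>j<N. ?f (y j)) \<in> borel_measurable (lborel_PiM N)"
          by (intro borel_measurable_sum measurable_compose [OF borel_measurable_PiM_component m]) auto
        then show "(\<lambda>y. \<Sum>j<N. ?f (y j)) \<in> borel_measurable (\<E> N)"
          by measurable
        show "AE y in \<E> N. h (\<Sum>j<N. k (y j)) = (\<Sum>j<N. ?f (y j))"
          using AE_ensemble [OF N]
          by eventually_elim (auto simp: h.sum max_def min_def intro!: sum.cong)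
      qed
      finally show ?thesis .
    qed
    then have "\<forall>\<^sub>F N in sequentially. h (avg N k) = (\<integral>y. (\<Sum>j<N. ?f (y j)) \<partial>\<E> N) / real N"
      by (intro eventually_mono [OF eventually_gt_at_top [of 0]])
    with lim have "(\<lambda>N. h (avg N k)) \<longlonglongrightarrow> (LINT t:{0<..<1}|lborel. ?f t * \<rho> t)"
      by (simp add: tendsto_cong)
    moreover have "(\<lambda>N. h (avg N k)) \<longlonglongrightarrow> h (Lam k)"
      by (rule h.tendsto [OF avg_tendsto [OF k]])
    ultimately have "h (Lam k) = (LINT t:{0<..<1}|lborel. ?f t * \<rho> t)"
      by (rule LIMSEQ_unique [rotated])
    also have "\<dots> = (LINT t:{0<..<1}|lborel. h (complex_of_real (\<rho> t) * k t))"
    proof (rule set_lebesgue_integral_cong, simp, intro allI impI)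
      fix t :: real assume "t \<in> {0<..<1}"
      then have "max 0 (min 1 t) = t" by auto
      then show "?f t * \<rho> t = h (complex_of_real (\<rho> t) * k t)"
        by (simp add: scaleR_conv_of_real [symmetric] h.scaleR)
    qed
    also have "\<dots> = h (LINT t:{0<..<1}|lborel. complex_of_real (\<rho> t) * k t)"
      unfolding set_lebesgue_integral_def
      using integral_bounded_linear [OF h int [unfolded set_integrable_def]] by (simp add: h.scaleR)
    finally show ?thesis .
  qed
  show ?thesis by (rule complex_eqI) (intro part bounded_linear_Re bounded_linear_Im)+
qed

end

section \<open>The main theorem\<close>

text \<open>The logarithmic derivative of x^(-\<alpha>) F(1/x) is -\<alpha>/x - \<alpha> K(1/x)/x^2,
  that is, -\<alpha> W; everything else follows from this and the Riccati equation for W.\<close>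

lemma (in jacobi_large_N) hypergeometric_solution:
  assumes \<alpha>: "\<alpha> \<noteq> 0" and C1: "C1 \<noteq> 0" and L: "log_branch_off_unit_interval U L"
  shows "\<exists>\<psi>. \<psi> holomorphic_on U \<and>
          (\<forall>x\<in>U. \<psi> x \<noteq> 0 \<longrightarrow> W10J a b \<alpha> x = - (deriv \<psi> x / (\<alpha>c * \<psi> x))) \<and>
          (\<forall>x\<in>U. x * (x - 1) * deriv (deriv \<psi>) x + (A - (A + B) * x) * deriv \<psi> x
                   - \<alpha>c * (1 + \<alpha>c + A + B) * \<psi> x = 0) \<and>
          \<psi> \<sim>[inf at_infinity (principal U)] (\<lambda>x. C1 * exp (- \<alpha>c * L x)) \<and>
          (\<forall>x\<in>U. \<psi> x = C1 * exp (- \<alpha>c * L x) *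
                     gauss_2F1 \<alpha>c (\<alpha>c + A + 1) (2 * \<alpha>c + A + B + 2) (1 / x))"
proof -
  have U: "open U" "L holomorphic_on U" "\<And>x. x \<in> U \<Longrightarrow> exp (L x) = x"
    and UD: "\<And>x. x \<in> U \<Longrightarrow> x \<notin> complex_of_real ` {0..1}"
    using L by (auto simp: log_branch_off_unit_interval_def)
  note inv = inverse_in_cut_plane [OF UD]
  obtain F where F: "F holomorphic_on cut_plane"
    "\<And>z. z \<in> cut_plane \<Longrightarrow> (F has_field_derivative \<alpha>c * resolvK z * F z) (at z)"
    "\<And>z. z \<in> cut_plane \<Longrightarrow> gauss_2F1 \<alpha>c (\<alpha>c + A + 1) (2 * \<alpha>c + A + B + 2) z = F z" "F 0 = 1"
    by (rule hypergeometric_primitive) blast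
  define \<psi> where "\<psi> x = C1 * exp (- \<alpha>c * L x) * F (1 / x)" for x
  let ?W = "W10J a b \<alpha>"
  \<comment> \<open>For an arbitrary branch the derivative 1/x is obtained by differentiating exp (L
    x) = x.\<close>
  have L': "(L has_field_derivative 1 / x) (at x)" if x: "x \<in> U" for x
  proof -
    have d: "(L has_field_derivative deriv L x) (at x)" by (rule holomorphic_derivI [OF U(2,1) x])
    then have "((\<lambda>x. exp (L x)) has_field_derivative exp (L x) * deriv L x) (at x)"
      by (auto intro!: derivative_eq_intros)
    then have "((\<lambda>x. x) has_field_derivative exp (L x) * deriv L x) (at x)"
      by (rule has_field_derivative_transform_within_open [OF _ U(1) x]) (rule U(3))
    then have "exp (L x) * deriv L x = 1" using DERIV_ident by (rule DERIV_unique)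
    then have "deriv L x = 1 / x" using U(3) [OF x] inv(1) [OF x] by (simp add: field_simps)
    with d show ?thesis by simp
  qed
  have \<psi>': "(\<psi> has_field_derivative - \<alpha>c * ?W x * \<psi> x) (at x)" if x: "x \<in> U" for x
  proof -
    have "((\<lambda>x. 1 / x) has_field_derivative - ((1 / x) * (1 / x))) (at x)"
      using inv(1) [OF x] by (auto intro!: derivative_eq_intros)
    from DERIV_chain2 [OF F(2) [OF inv(2) [OF x]] this]
    have F': "((\<lambda>x. F (1 / x)) has_field_derivative \<alpha>c * resolvK (1 / x) * F (1 / x) * - ((1 / x) * (1 / x))) (at x)" .
    have E': "((\<lambda>x. C1 * exp (- \<alpha>c * L x)) has_field_derivative C1 * (exp (- \<alpha>c * L x) * (- \<alpha>c * (1 / x)))) (at x)"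
      by (intro DERIV_cmult DERIV_fun_exp L' [OF x])
    show ?thesis unfolding \<psi>_def [abs_def]
      by (rule DERIV_cong [OF DERIV_mult [OF E' F']])
         (simp only: W10J_eq_resolvK [OF UD [OF x]], simp add: algebra_simps)
  qed
  have d\<psi>: "deriv \<psi> x = - \<alpha>c * ?W x * \<psi> x" if "x \<in> U" for x
    using \<psi>' [OF that] by (rule DERIV_imp_deriv)
  have holo: "\<psi> holomorphic_on U"
    using \<psi>' has_field_derivative_at_within unfolding holomorphic_on_def field_differentiable_def by blast
  have W': "(?W has_field_derivative deriv ?W x) (at x)" if "x \<in> U" for x
    using W10J_has_field_derivative [OF UD [OF that]] by (metis DERIV_imp_deriv)
  have ode: "x * (x - 1) * deriv (deriv \<psi>) x + (A - (A + B) * x) * deriv \<psi> x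
                   - \<alpha>c * (1 + \<alpha>c + A + B) * \<psi> x = 0" if x: "x \<in> U" for x
  proof -
    have "((\<lambda>x. - \<alpha>c * ?W x * \<psi> x) has_field_derivative
        (- \<alpha>c * deriv ?W x) * \<psi> x + (- \<alpha>c * ?W x * \<psi> x) * (- \<alpha>c * ?W x)) (at x)"
      by (intro DERIV_mult DERIV_cmult W' [OF x] \<psi>' [OF x])
    then have "(deriv \<psi> has_field_derivative
        (- \<alpha>c * deriv ?W x) * \<psi> x + (- \<alpha>c * ?W x * \<psi> x) * (- \<alpha>c * ?W x)) (at x)"
      by (rule has_field_derivative_transform_within_open [OF _ U(1) x]) (simp add: d\<psi>)
    then have dd: "deriv (deriv \<psi>) x = (- \<alpha>c * deriv ?W x) * \<psi> x + (- \<alpha>c * ?W x * \<psi> x) * (- \<alpha>c * ?W x)"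
      by (rule DERIV_imp_deriv)
    have x0: "x \<noteq> 0" by (rule inv(1) [OF x])
    have x1: "x \<noteq> 1" using UD [OF x] by (auto intro: image_eqI [of _ _ 1])
    define R where "R = - deriv ?W x + (A / x - B / (1 - x)) * ?W x
             + (1 + A + B + \<alpha>c) / (x * (1 - x)) + \<alpha>c * (?W x)\<^sup>2"
    have "x * (x - 1) * R = x * (x - 1) * (- deriv ?W x) + (A * (x - 1) + B * x) * ?W x
       - (1 + A + B + \<alpha>c) + x * (x - 1) * (\<alpha>c * (?W x)\<^sup>2)"
    proof -
      have "x * (x - 1) * (A / x - B / (1 - x)) = A * (x - 1) + B * x"
        using x0 x1 by (simp add: divide_simps) (simp add: algebra_simps)
      moreover have "x * (x - 1) * ((1 + A + B + \<alpha>c) / (x * (1 - x))) = - (1 + A + B + \<alpha>c)"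
        using x0 x1 by (simp add: divide_simps) (simp add: algebra_simps)
      ultimately show ?thesis unfolding R_def by (simp only: distrib_left mult.assoc [symmetric]) simp
    qed
    moreover have "R = 0" unfolding R_def by (rule W10J_Riccati [OF UD [OF x]])
    ultimately have R0: "x * (x - 1) * (- deriv ?W x) + (A * (x - 1) + B * x) * ?W x
       - (1 + A + B + \<alpha>c) + x * (x - 1) * (\<alpha>c * (?W x)\<^sup>2) = 0" by simp
    \<comment> \<open>Since \<psi>'' = \<alpha> \<psi> (-W' + \<alpha> W^2), the differential
      expression is \<alpha> \<psi> times x (x - 1) times the Riccati expression.\<close>
    have "x * (x - 1) * deriv (deriv \<psi>) x + (A - (A + B) * x) * deriv \<psi> x
                   - \<alpha>c * (1 + \<alpha>c + A + B) * \<psi> x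
       = \<alpha>c * \<psi> x * (x * (x - 1) * (- deriv ?W x) + (A * (x - 1) + B * x) * ?W x
       - (1 + A + B + \<alpha>c) + x * (x - 1) * (\<alpha>c * (?W x)\<^sup>2))"
      unfolding dd d\<psi> [OF x] by (simp add: algebra_simps power2_eq_square)
    then show ?thesis unfolding R0 by simp
  qed
  have asymp: "\<psi> \<sim>[inf at_infinity (principal U)] (\<lambda>x. C1 * exp (- \<alpha>c * L x))"
  proof (rule asymp_equivI')
    \<comment> \<open>The quotient to be shown asymptotic to 1 is F(1/x), which tends to F(0) = 1 as
      1/x tends to 0.\<close>
    have "isCont F 0" using F(2) [OF zero_in_cut_plane] by (rule DERIV_isCont)
    then have "((\<lambda>x. F (1 / x)) \<longlongrightarrow> F 0) at_infinity"
      by (rule isCont_tendsto_compose) (simp add: tendsto_inverse_0 inverse_eq_divide [symmetric])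
    then have "((\<lambda>x. F (1 / x)) \<longlongrightarrow> 1) (inf at_infinity (principal U))"
      unfolding F(4) by (rule tendsto_mono [OF inf_le1])
    then show "((\<lambda>x. \<psi> x / (C1 * exp (- \<alpha>c * L x))) \<longlongrightarrow> 1) (inf at_infinity (principal U))"
      using C1 by (simp add: \<psi>_def)
  qed
  show ?thesis
  proof (intro exI [of _ \<psi>] conjI ballI impI holo asymp ode)
    fix x assume x: "x \<in> U"
    show "?W x = - (deriv \<psi> x / (\<alpha>c * \<psi> x))" if "\<psi> x \<noteq> 0"
      using that \<alpha> by (simp add: d\<psi> [OF x])
    show "\<psi> x = C1 * exp (- \<alpha>c * L x) * gauss_2F1 \<alpha>c (\<alpha>c + A + 1) (2 * \<alpha>c + A + B + 2) (1 / x)"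
      using F(3) [OF inv(2) [OF x]] by (simp add: \<psi>_def)
  qed
qed

theorem mainTheorem3:
  fixes \<alpha> \<alpha>1 \<alpha>2 :: real
  defines "W \<equiv> W10J \<alpha>1 \<alpha>2 \<alpha>"
    and "a \<equiv> complex_of_real \<alpha>"
    and "a1 \<equiv> complex_of_real \<alpha>1"
    and "a2 \<equiv> complex_of_real \<alpha>2"
    and "D \<equiv> - (complex_of_real ` {0..1})"
  assumes "\<alpha>1 > -1" and "\<alpha>2 > -1"
    and "\<alpha> > - min 1 (min (1 + \<alpha>1) (1 + \<alpha>2))" and "\<alpha> \<noteq> 0"
    and "large_N_ansatz \<alpha>1 \<alpha>2 \<alpha>"
  shows "(\<forall>x\<in>D. (\<lambda>N. jacobi_resolvent \<alpha>1 \<alpha>2 \<alpha> N x / of_nat N) \<longlonglongrightarrow> W x) \<and>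
    (\<forall>\<rho>. jacobi_limiting_density \<alpha>1 \<alpha>2 \<alpha> \<rho> \<longrightarrow> (\<forall>x\<in>D. W x = stieltjes_transform \<rho> x)) \<and>
    W holomorphic_on D \<and>
    (\<forall>x\<in>D. - deriv W x + (a1 / x - a2 / (1 - x)) * W x
             + (1 + a1 + a2 + a) / (x * (1 - x)) + a * (W x)\<^sup>2 = 0) \<and>
    (\<forall>C1 U L. C1 \<noteq> 0 \<and> log_branch_off_unit_interval U L \<longrightarrow>
       (\<exists>\<psi>. \<psi> holomorphic_on U \<and>
          (\<forall>x\<in>U. \<psi> x \<noteq> 0 \<longrightarrow> W x = - (deriv \<psi> x / (a * \<psi> x))) \<and>
          (\<forall>x\<in>U. x * (x - 1) * deriv (deriv \<psi>) x + (a1 - (a1 + a2) * x) * deriv \<psi> x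
                   - a * (1 + a + a1 + a2) * \<psi> x = 0) \<and>
          \<psi> \<sim>[inf at_infinity (principal U)] (\<lambda>x. C1 * exp (- a * L x)) \<and>
          (\<forall>x\<in>U. \<psi> x = C1 * exp (- a * L x) *
                     gauss_2F1 a (a + a1 + 1) (2 * a + a1 + a2 + 2) (1 / x))))"
proof -
  interpret jacobi_large_N \<alpha>1 \<alpha>2 \<alpha>
    by unfold_locales fact+
  have W_lim: "(\<lambda>N. jacobi_resolvent \<alpha>1 \<alpha>2 \<alpha> N x / of_nat N) \<longlonglongrightarrow> W x" if "x \<in> D" for x
    using avg_tendsto [OF test_fun_resolvent, of x] that
    by (simp add: jacobi_resolvent_eq_avg W_def W10J_eq_Lam D_def)
  have W_density: "W x = stieltjes_transform \<rho> x"
    if "jacobi_limiting_density \<alpha>1 \<alpha>2 \<alpha> \<rho>" "x \<in> D" for \<rho> x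
    using Lam_limiting_density [OF that(1) test_fun_resolvent, of x] that(2)
    by (simp add: W_def W10J_eq_Lam D_def stieltjes_transform_def)
  have W_holo: "W holomorphic_on D"
    unfolding holomorphic_on_def field_differentiable_def W_def D_def
    using W10J_has_field_derivative has_field_derivative_at_within by blast
  show ?thesis
    using W_lim W_density W_holo W10J_Riccati hypergeometric_solution [OF \<open>\<alpha> \<noteq> 0\<close>]
    unfolding W_def D_def a_def a1_def a2_def by simp
qed

end
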